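(* Let $\varphi$ be a smooth real-valued function on a domain $\Omega\subset\mathbb{C}^n$. Then the following are equivalent: (1) $\sqrt{-1}\partial\overline{\partial}\varphi=0$ on $\Omega$ (i.e. $\varphi$ is pluriharmonic); (2) $L_\varphi\equiv1$ on $\Omega_{\widetilde\delta}$; that is, for every $(a,r,s,A)\in\Omega_{\widetilde\delta}$ there exists a unique holomorphic function $f$ on $a+P_{A,r,s}$ with $f(a)=1$ and $\int_{a+P_{A,r,s}}|f|^2e^{-\varphi}\leq|P_{A,r,s}|e^{-\varphi(a)}$.
   Context: $\Delta_r=\{z\in\mathbb{C}\mid|z|<r\}$, $\mathbb{B}^m_s=\{z\in\mathbb{C}^m\mid|z|<s\}$, $\mathbf{U}(n)$ the unitary group, and for $r,s>0$, $A\in\mathbf{U}(n)$ the holomorphic cylinder $P_{A,r,s}=A(\Delta_r\times\mathbb{B}^{n-1}_s)$, with Lebesgue volume $|P_{A,r,s}|$. $\Omega_{\widetilde\delta}=\{(a,r,s,A)\in\Omega\times\mathbb{R}_{>0}\times\mathbb{R}_{>0}\times\mathbf{U}(n)\mid a+P_{A,r,s}\subset\Omega\}$. The $L^2$-extension index is $$L_\varphi(a,r,s,A)=\inf\left\{\frac{\int_{a+P_{A,r,s}}|f|^2e^{-\varphi}}{|P_{A,r,s}|e^{-\varphi(a)}}\ \middle|\ f\text{ holomorphic on }a+P_{A,r,s},\ \int_{a+P_{A,r,s}}|f|^2e^{-\varphi}<\infty,\ f(a)=1\right\}.$$ *)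

theory Defs
  imports "HOL-Analysis.Analysis"
begin

fun Ck_on :: "nat \<Rightarrow> 'a::real_normed_vector set \<Rightarrow> ('a \<Rightarrow> real) \<Rightarrow> bool" where
  "Ck_on 0 S f = continuous_on S f"
| "Ck_on (Suc k) S f = (f differentiable_on S \<and>
       (\<forall>v. Ck_on k S (\<lambda>x. frechet_derivative f (at x) v)))"

definition smooth_on :: "'a::real_normed_vector set \<Rightarrow> ('a \<Rightarrow> real) \<Rightarrow> bool" where
  "smooth_on S f \<longleftrightarrow> (\<forall>k. Ck_on k S f)"

definition dderiv :: "('a::real_normed_vector \<Rightarrow> real) \<Rightarrow> 'a \<Rightarrow> 'a \<Rightarrow> real" where
  "dderiv f x u = frechet_derivative f (at x) u"

definition dderiv2 :: "('a::real_normed_vector \<Rightarrow> real) \<Rightarrow> 'a \<Rightarrow> 'a \<Rightarrow> 'a \<Rightarrow> real" where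
  "dderiv2 f x u v = dderiv (\<lambda>y. dderiv f y v) x u"

text \<open>Complex Hessian entry  d^2 f / (dz_j d conj z_k) at x, where z_j = x_j + i y_j:
  (1/4) [ d_xj d_xk + d_yj d_yk + i (d_xj d_yk - d_yj d_xk) ] f.\<close>
definition ddbar :: "(complex^'n \<Rightarrow> real) \<Rightarrow> complex^'n \<Rightarrow> 'n \<Rightarrow> 'n \<Rightarrow> complex" where
  "ddbar f x j k =
     (complex_of_real (dderiv2 f x (axis j 1) (axis k 1) + dderiv2 f x (axis j \<i>) (axis k \<i>))
      + \<i> * complex_of_real (dderiv2 f x (axis j 1) (axis k \<i>) - dderiv2 f x (axis j \<i>) (axis k 1))) / 4"

definition pluriharmonic_on :: "(complex^'n) set \<Rightarrow> (complex^'n \<Rightarrow> real) \<Rightarrow> bool" where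
  "pluriharmonic_on S f \<longleftrightarrow> (\<forall>x\<in>S. \<forall>j k. ddbar f x j k = 0)"

definition holo_on :: "(complex^'n) set \<Rightarrow> (complex^'n \<Rightarrow> complex) \<Rightarrow> bool" where
  "holo_on S f \<longleftrightarrow> (\<forall>x\<in>S. \<exists>L. (f has_derivative L) (at x within S) \<and>
                       (\<forall>c v. L (c *s v) = c * L v))"

definition unitary :: "complex^'n^'n \<Rightarrow> bool" where
  "unitary A \<longleftrightarrow> (\<chi> i j. cnj (A $ j $ i)) ** A = mat 1"

text \<open>The distinguished first coordinate of C^n (the splitting C^n = C x C^(n-1)).\<close>
definition first_idx :: "'n" where
  "first_idx = (SOME i. True)"

definition cyl0 :: "real \<Rightarrow> real \<Rightarrow> (complex^'n) set" where
  "cyl0 r s = {z. cmod (z $ first_idx) < r \<and>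
                  sqrt (\<Sum>i\<in>UNIV - {first_idx}. (cmod (z $ i))\<^sup>2) < s}"

definition cyl :: "complex^'n^'n \<Rightarrow> real \<Rightarrow> real \<Rightarrow> (complex^'n) set" where
  "cyl A r s = (\<lambda>z. A *v z) ` cyl0 r s"

definition Omega_td :: "(complex^'n) set \<Rightarrow> ((complex^'n) \<times> real \<times> real \<times> (complex^'n^'n)) set" where
  "Omega_td \<Omega> = {(a, r, s, A). a \<in> \<Omega> \<and> r > 0 \<and> s > 0 \<and> unitary A \<and>
                                  (\<lambda>z. a + z) ` cyl A r s \<subseteq> \<Omega>}"

end

theory Submission
  imports Defs "HOL-Complex_Analysis.Cauchy_Integral_Formula"
begin

text \<open>
  Everything rests on the mean value inequality \<open>\<integral>\<^sub>P |g|\<^sup>2 e\<^sup>-\<^sup>W \<ge> |g(0)|\<^sup>2 \<integral>\<^sub>P e\<^sup>-\<^sup>W\<close> for \<open>g\<close> holomorphic on a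
  balanced open set \<open>P\<close> and a weight \<open>W\<close> invariant under \<open>z \<mapsto> e\<^sup>i\<^sup>\<theta> z\<close>: average over the rotations and apply
  Cauchy's formula on each disc \<open>{w z | |w| \<le> 1}\<close>. Moreover, multiplying competitors by \<open>exp (- q / 2)\<close> with
  \<open>q\<close> holomorphic and \<open>q 0 = 0\<close> replaces the weight \<open>\<psi> z = \<phi> (a + A z) - \<phi> a\<close> by \<open>\<psi> - Re q\<close>.

  If \<open>\<phi>\<close> is pluriharmonic, it is the real part of a holomorphic function on the (convex) cylinder, so the
  weight can be reduced to \<open>0\<close>, where the inequality for \<open>(g + 1) / 2\<close> and the parallelogram law force \<open>g = 1\<close>.

  Conversely, Taylor's formula at \<open>a\<close> reduces the weight to the Levi form up to \<open>o(|z|\<^sup>2)\<close>, which on a cylinder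
  that is thin around a direction \<open>\<xi>\<close> is \<open>\<kappa> |z\<^sub>1|\<^sup>2\<close>, where \<open>\<kappa>\<close> is the Levi form at \<open>\<xi>\<close>. The mean value inequality
  turns existence of a competitor into \<open>\<integral> exp (- \<kappa> |z\<^sub>1|\<^sup>2) \<le> |P|\<close>; uniqueness gives \<open>\<ge>\<close>, because a strict
  inequality would leave room to perturb the competitor \<open>1\<close>. Hence \<open>\<kappa> = 0\<close>.
\<close>

section \<open>Lebesgue integrals and orthogonal maps\<close>

lemma nn_integral_lborel_translation:
  fixes f :: "'a::euclidean_space \<Rightarrow> ennreal"
  assumes [measurable]: "f \<in> borel_measurable borel"
  shows "(\<integral>\<^sup>+ x. f (a + x) \<partial>lborel) = (\<integral>\<^sup>+ x. f x \<partial>lborel)"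
  by (subst (2) lborel_distr_plus[symmetric, of a]) (simp add: nn_integral_distr)

lemma nn_integral_lborel_reflection:
  fixes f :: "'a::euclidean_space \<Rightarrow> ennreal"
  assumes [measurable]: "f \<in> borel_measurable borel"
  shows "(\<integral>\<^sup>+ x. f (a - x) \<partial>lborel) = (\<integral>\<^sup>+ x. f x \<partial>lborel)"
  by (subst (2) lborel_affine[of "- 1" a]) (simp_all add: density_1 nn_integral_distr)

text \<open>This is how Haar measure is shown to be unique: integrate \<open>f (T x + y) g y\<close> in both orders.\<close>
lemma nn_integral_lborel_linear_mult:
  fixes T :: "'a::euclidean_space \<Rightarrow> 'a" and f g :: "'a \<Rightarrow> ennreal"
  assumes T: "linear T" "surj T"
    and [measurable]: "f \<in> borel_measurable borel" "g \<in> borel_measurable borel"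
  shows "(\<integral>\<^sup>+ x. f (T x) \<partial>lborel) * (\<integral>\<^sup>+ y. g y \<partial>lborel)
    = (\<integral>\<^sup>+ y. f y \<partial>lborel) * (\<integral>\<^sup>+ x. g (T x) \<partial>lborel)"
proof -
  define S where "S = inv T"
  have TS: "T (S y) = y" for y using T(2) by (simp add: S_def surj_f_inv_f)
  have [measurable]: "T \<in> borel_measurable borel"
    using T(1) by (intro borel_measurable_continuous_onI linear_continuous_on) (simp add: linear_linear)
  have shift_x: "(\<integral>\<^sup>+ x. f (T x) * g y \<partial>lborel) = (\<integral>\<^sup>+ x. f (T x + y) * g y \<partial>lborel)" for y
    using nn_integral_lborel_translation[of "\<lambda>x. f (T x) * g y" "S y"]
    by (simp add: linear_add[OF T(1)] TS add.commute)
  have shift_y: "(\<integral>\<^sup>+ y. f (T x + y) * g y \<partial>lborel) = (\<integral>\<^sup>+ y. f y * g (y - T x) \<partial>lborel)" for x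
    using nn_integral_lborel_translation[of "\<lambda>y. f (T x + y) * g y" "- T x"] by simp
  have reflect_x: "(\<integral>\<^sup>+ x. g (y - T x) \<partial>lborel) = (\<integral>\<^sup>+ x. g (T x) \<partial>lborel)" for y
    using nn_integral_lborel_reflection[of "\<lambda>x. g (T x)" "S y"] by (simp add: linear_diff[OF T(1)] TS)
  have "(\<integral>\<^sup>+ x. f (T x) \<partial>lborel) * (\<integral>\<^sup>+ y. g y \<partial>lborel)
      = (\<integral>\<^sup>+ y. \<integral>\<^sup>+ x. f (T x) * g y \<partial>lborel \<partial>lborel)"
    by (simp add: nn_integral_multc nn_integral_cmult)
  also have "\<dots> = (\<integral>\<^sup>+ x. \<integral>\<^sup>+ y. f (T x + y) * g y \<partial>lborel \<partial>lborel)"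
    unfolding shift_x by (rule lborel_pair.Fubini') measurable
  also have "\<dots> = (\<integral>\<^sup>+ y. \<integral>\<^sup>+ x. f y * g (y - T x) \<partial>lborel \<partial>lborel)"
    unfolding shift_y by (rule lborel_pair.Fubini'[symmetric]) measurable
  also have "\<dots> = (\<integral>\<^sup>+ y. f y \<partial>lborel) * (\<integral>\<^sup>+ x. g (T x) \<partial>lborel)"
    by (simp add: nn_integral_multc nn_integral_cmult reflect_x)
  finally show ?thesis .
qed

lemma nn_integral_lborel_orthogonal:
  fixes T :: "'a::euclidean_space \<Rightarrow> 'a" and f :: "'a \<Rightarrow> ennreal"
  assumes T: "orthogonal_transformation T" and [measurable]: "f \<in> borel_measurable borel"
  shows "(\<integral>\<^sup>+ x. f (T x) \<partial>lborel) = (\<integral>\<^sup>+ x. f x \<partial>lborel)"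
proof -
  define \<beta> :: "'a \<Rightarrow> ennreal" where "\<beta> = indicator (ball 0 1)"
  let ?V = "\<integral>\<^sup>+ x. \<beta> x \<partial>lborel"
  have [measurable]: "\<beta> \<in> borel_measurable borel"
    unfolding \<beta>_def by (rule borel_measurable_indicator) simp
  have "\<beta> (T x) = \<beta> x" for x
    using T by (simp add: \<beta>_def indicator_def orthogonal_transformation)
  then have "?V * (\<integral>\<^sup>+ x. f (T x) \<partial>lborel) = ?V * (\<integral>\<^sup>+ x. f x \<partial>lborel)"
    using nn_integral_lborel_linear_mult[of T f \<beta>] T
    by (simp add: orthogonal_transformation_linear orthogonal_transformation_surj mult.commute)
  moreover have "?V \<noteq> 0" "?V \<noteq> top"
    using unit_ball_vol_pos[of "real DIM('a)", THEN less_imp_neq] by (simp_all add: \<beta>_def emeasure_ball)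
  ultimately show ?thesis by (simp add: ennreal_mult_cancel_left)
qed

lemma open_orthogonal_affine_image:
  fixes T :: "'a::euclidean_space \<Rightarrow> 'a"
  assumes "orthogonal_transformation T" "open S"
  shows "open ((\<lambda>z. a + T z) ` S)"
proof -
  have "open ((\<lambda>z. a + z) ` T ` S)"
    using assms by (intro open_translation open_surjective_linear_image)
      (simp_all add: orthogonal_transformation_linear orthogonal_transformation_surj)
  then show ?thesis by (simp add: image_image)
qed

lemma borel_measurable_ennreal_continuous_indicator:
  fixes f :: "'a::topological_space \<Rightarrow> real"
  assumes "S \<in> sets borel" "continuous_on S f"
  shows "(\<lambda>x. ennreal (f x) * indicator S x) \<in> borel_measurable borel"
proof -
  have "(\<lambda>x. ennreal (indicator S x *\<^sub>R f x)) \<in> borel_measurable borel"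
    using borel_measurable_continuous_on_indicator[OF assms] by measurable
  also have "(\<lambda>x. ennreal (indicator S x *\<^sub>R f x)) = (\<lambda>x. ennreal (f x) * indicator S x)"
    by (auto simp: indicator_def)
  finally show ?thesis .
qed

lemma set_nn_integral_orthogonal_affine_image:
  fixes T :: "'a::euclidean_space \<Rightarrow> 'a" and F :: "'a \<Rightarrow> real"
  assumes T: "orthogonal_transformation T" and S: "open S" and F: "continuous_on ((\<lambda>z. a + T z) ` S) F"
  shows "(\<integral>\<^sup>+ x\<in>(\<lambda>z. a + T z) ` S. ennreal (F x) \<partial>lebesgue) = (\<integral>\<^sup>+ z\<in>S. ennreal (F (a + T z)) \<partial>lborel)"
proof -
  let ?\<Phi> = "\<lambda>z. a + T z" and ?G = "\<lambda>x. ennreal (F x) * indicator ((\<lambda>z. a + T z) ` S) x"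
  have inj: "inj T" using T by (rule orthogonal_transformation_inj)
  have G [measurable]: "?G \<in> borel_measurable borel"
    using open_orthogonal_affine_image[OF T S] F by (intro borel_measurable_ennreal_continuous_indicator borel_open)
  have "(\<integral>\<^sup>+ x. ?G x \<partial>lebesgue) = (\<integral>\<^sup>+ x. ?G x \<partial>lborel)"
    by (rule nn_integral_completion)
  also have "\<dots> = (\<integral>\<^sup>+ x. ?G (a + x) \<partial>lborel)"
    by (rule nn_integral_lborel_translation[symmetric]) fact
  also have "\<dots> = (\<integral>\<^sup>+ z. ?G (a + T z) \<partial>lborel)"
    by (rule nn_integral_lborel_orthogonal[OF T, symmetric]) measurable
  also have "\<dots> = (\<integral>\<^sup>+ z\<in>S. ennreal (F (?\<Phi> z)) \<partial>lborel)"
    using inj by (intro nn_integral_cong) (auto simp: indicator_def inj_eq)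
  finally show ?thesis .
qed

lemma emeasure_lebesgue_orthogonal_image:
  fixes T :: "'a::euclidean_space \<Rightarrow> 'a"
  assumes "orthogonal_transformation T" "open S"
  shows "emeasure lebesgue (T ` S) = emeasure lborel S"
proof -
  have "T ` S \<in> sets borel"
    using open_orthogonal_affine_image[OF assms, of 0] by simp
  then show ?thesis
    using set_nn_integral_orthogonal_affine_image[OF assms, of 0 "\<lambda>_. 1"] assms(2) by simp
qed

lemma open_continuous_set_nn_integral_eq_0:
  fixes f :: "'a::euclidean_space \<Rightarrow> real"
  assumes S: "open S" and f: "continuous_on S f" "\<And>x. x \<in> S \<Longrightarrow> 0 \<le> f x"
    and integral_0: "(\<integral>\<^sup>+ x\<in>S. ennreal (f x) \<partial>lborel) = 0" and x: "x \<in> S"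
  shows "f x = 0"
proof -
  have "(\<lambda>x. ennreal (f x) * indicator S x) \<in> borel_measurable lborel"
    using S f by (simp add: borel_measurable_ennreal_continuous_indicator)
  then have "AE x in lebesgue. ennreal (f x) * indicator S x = 0"
    using integral_0 by (intro AE_completion) (simp add: nn_integral_0_iff_AE)
  then have "negligible {x. ennreal (f x) * indicator S x \<noteq> 0}"
    unfolding eventually_ae_filter_negligible by (blast intro: negligible_subset)
  moreover have "{x. ennreal (f x) * indicator S x \<noteq> 0} = S \<inter> f -` {0<..}"
    using f(2) by (auto simp: indicator_def ennreal_eq_0_iff not_le)
  moreover have "open (S \<inter> f -` {0<..})"
    using continuous_open_preimage[OF f(1) S] by simp
  ultimately have "S \<inter> f -` {0<..} = {}"
    using open_not_negligible by metis
  then show ?thesis using f(2)[OF x] x by force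
qed

lemma set_integrable_continuous_bounded:
  fixes f :: "'a::euclidean_space \<Rightarrow> real"
  assumes "continuous_on UNIV f" "bounded S" "S \<in> sets borel"
  shows "set_integrable lborel S f"
proof (rule set_integrable_subset[of _ "closure S"])
  show "set_integrable lborel (closure S) f"
    unfolding set_integrable_def
    by (intro borel_integrable_compact continuous_on_subset[OF assms(1)]) (simp_all add: assms(2))
qed (use assms closure_subset in auto)

lemma set_nn_integral_eq_set_integral:
  assumes "set_integrable M A f" "\<And>x. x \<in> A \<Longrightarrow> 0 \<le> f x"
  shows "(\<integral>\<^sup>+ x\<in>A. ennreal (f x) \<partial>M) = ennreal (LINT x:A|M. f x)"
proof -
  have "(\<integral>\<^sup>+ x\<in>A. ennreal (f x) \<partial>M) = (\<integral>\<^sup>+ x. ennreal (indicator A x *\<^sub>R f x) \<partial>M)"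
    by (intro nn_integral_cong) (simp add: indicator_def)
  also have "\<dots> = ennreal (LINT x:A|M. f x)"
    using assms unfolding set_integrable_def set_lebesgue_integral_def
    by (intro nn_integral_eq_integral) (auto simp: indicator_def)
  finally show ?thesis .
qed

lemma measure_disjoint_translates_le:
  fixes C P :: "'a::euclidean_space set"
  assumes meas: "C \<in> lmeasurable" "P \<in> lmeasurable"
    and sub: "(\<lambda>x. a + x) ` C \<subseteq> P" "(\<lambda>x. b + x) ` C \<subseteq> P"
    and disjoint: "(\<lambda>x. a + x) ` C \<inter> (\<lambda>x. b + x) ` C = {}"
  shows "2 * measure lebesgue C \<le> measure lebesgue P"
proof -
  have C: "(\<lambda>x. v + x) ` C \<in> lmeasurable" for v
    by (rule measurable_translation[OF meas(1)])
  have "2 * measure lebesgue C = measure lebesgue ((\<lambda>x. a + x) ` C) + measure lebesgue ((\<lambda>x. b + x) ` C)"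
    unfolding measure_translation by simp
  also have "\<dots> = measure lebesgue ((\<lambda>x. a + x) ` C \<union> (\<lambda>x. b + x) ` C)"
    unfolding measure_Un3[OF C C] disjoint by simp
  also have "\<dots> \<le> measure lebesgue P"
    using sub by (intro measure_mono_fmeasurable fmeasurableD fmeasurable.Un C meas Un_least)
  finally show ?thesis .
qed

section \<open>Holomorphic functions of several variables\<close>

lemma norm_vector_smult: "norm (c *s (z::complex^'n)) = cmod c * norm z"
  by (simp add: norm_vec_def L2_set_def norm_mult power_mult_distrib real_sqrt_mult
      flip: sum_distrib_left)

lemma bounded_bilinear_vector_smult: "bounded_bilinear (\<lambda>c (z::complex^'n). c *s z)"
  by (rule bounded_bilinear.intro)
     (auto simp: norm_vector_smult vec_eq_iff algebra_simps intro!: exI[of _ 1])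

lemmas has_derivative_vector_smult = bounded_bilinear.FDERIV[OF bounded_bilinear_vector_smult]
  and continuous_on_vector_smult [continuous_intros] =
    bounded_bilinear.continuous_on[OF bounded_bilinear_vector_smult]
  and linear_vector_smult =
    bounded_linear.linear[OF bounded_bilinear.bounded_linear_right[OF bounded_bilinear_vector_smult]]

lemma orthogonal_transformation_vector_smult:
  "cmod c = 1 \<Longrightarrow> orthogonal_transformation (\<lambda>z::complex^'n. c *s z)"
  by (simp add: orthogonal_transformation norm_vector_smult linear_vector_smult)

lemma vector_smult_eq_scaleR: "c *s v = Re c *\<^sub>R v + Im c *\<^sub>R (\<i> *s (v::complex^'n))"
  by (simp add: vec_eq_iff complex_eq_iff)

lemma complex_linearI:
  fixes L :: "complex^'n \<Rightarrow> complex"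
  assumes "linear L" "\<And>v. L (\<i> *s v) = \<i> * L v"
  shows "L (c *s v) = c * L v"
  unfolding vector_smult_eq_scaleR[of c v] linear_add[OF assms(1)] linear_scale[OF assms(1)] assms(2)
  by (simp add: complex_eq_iff)

lemma holo_onI:
  assumes "\<And>x. x \<in> S \<Longrightarrow> (f has_derivative L x) (at x within S)"
    and "\<And>x c v. x \<in> S \<Longrightarrow> L x (c *s v) = c * L x v"
  shows "holo_on S f"
  using assms unfolding holo_on_def by blast

lemma holo_onE:
  assumes "holo_on S f"
  obtains L where "\<And>x. x \<in> S \<Longrightarrow> (f has_derivative L x) (at x within S)"
    and "\<And>x c v. x \<in> S \<Longrightarrow> L x (c *s v) = c * L x v"
  using assms unfolding holo_on_def by metis

lemma holo_on_imp_continuous_on: "holo_on S f \<Longrightarrow> continuous_on S f"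
  unfolding holo_on_def continuous_on_eq_continuous_within
  by (blast intro: has_derivative_continuous)

lemma holo_on_subset: "holo_on S f \<Longrightarrow> T \<subseteq> S \<Longrightarrow> holo_on T f"
  unfolding holo_on_def by (blast intro: has_derivative_subset)

lemma holo_on_cong:
  assumes "\<And>x. x \<in> S \<Longrightarrow> f x = g x"
  shows "holo_on S f \<longleftrightarrow> holo_on S g"
  unfolding holo_on_def using assms by (metis has_derivative_transform)

lemma holo_on_const: "holo_on S (\<lambda>_. c)"
  by (rule holo_onI[of _ _ "\<lambda>_ _. 0"]) auto

lemma holo_on_component: "holo_on S (\<lambda>z. z $ j)"
  by (rule holo_onI[of _ _ "\<lambda>_ v. v $ j"])
     (auto intro: bounded_linear.has_derivative[OF bounded_linear_vec_nth])

lemma holo_on_add: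
  assumes "holo_on S f" "holo_on S g"
  shows "holo_on S (\<lambda>x. f x + g x)"
proof -
  obtain L M where
    "\<And>x. x \<in> S \<Longrightarrow> (f has_derivative L x) (at x within S)" "\<And>x c v. x \<in> S \<Longrightarrow> L x (c *s v) = c * L x v"
    "\<And>x. x \<in> S \<Longrightarrow> (g has_derivative M x) (at x within S)" "\<And>x c v. x \<in> S \<Longrightarrow> M x (c *s v) = c * M x v"
    using assms by (metis holo_onE)
  then show ?thesis
    by (intro holo_onI[of _ _ "\<lambda>x v. L x v + M x v"] has_derivative_add) (auto simp: algebra_simps)
qed

lemma holo_on_mult:
  assumes "holo_on S f" "holo_on S g"
  shows "holo_on S (\<lambda>x. f x * g x)"
proof -
  obtain L M where
    "\<And>x. x \<in> S \<Longrightarrow> (f has_derivative L x) (at x within S)" "\<And>x c v. x \<in> S \<Longrightarrow> L x (c *s v) = c * L x v"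
    "\<And>x. x \<in> S \<Longrightarrow> (g has_derivative M x) (at x within S)" "\<And>x c v. x \<in> S \<Longrightarrow> M x (c *s v) = c * M x v"
    using assms by (metis holo_onE)
  then show ?thesis
    by (intro holo_onI[of _ _ "\<lambda>x v. f x * M x v + L x v * g x"] has_derivative_mult)
       (auto simp: algebra_simps)
qed

lemma holo_on_exp:
  assumes "holo_on S f"
  shows "holo_on S (\<lambda>x. exp (f x))"
proof -
  obtain L where L: "\<And>x. x \<in> S \<Longrightarrow> (f has_derivative L x) (at x within S)"
    "\<And>x c v. x \<in> S \<Longrightarrow> L x (c *s v) = c * L x v"
    using assms by (metis holo_onE)
  have "(exp has_derivative (\<lambda>h. exp (f x) * h)) (at (f x))" for x
    using DERIV_exp[of "f x"] by (simp add: has_field_derivative_def)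
  from has_derivative_compose[OF L(1) this] show ?thesis
    by (rule holo_onI) (auto simp: L(2))
qed

lemma bounded_linear_matrix_vector_mult: "bounded_linear (\<lambda>z. (A::complex^'n^'m) *v z)"
  unfolding linear_conv_bounded_linear[symmetric]
  by (rule linearI)
     (simp_all add: matrix_vector_right_distrib, simp add: vec_eq_iff matrix_vector_mult_def scaleR_sum_right)

lemma holo_on_compose_affine:
  fixes A :: "complex^'n^'m"
  assumes "holo_on ((\<lambda>z. a + A *v z) ` S) f"
  shows "holo_on S (\<lambda>z. f (a + A *v z))"
proof -
  let ?T = "\<lambda>z. a + A *v z"
  obtain L where L: "\<And>x. x \<in> ?T ` S \<Longrightarrow> (f has_derivative L x) (at x within ?T ` S)"
      "\<And>x c v. x \<in> ?T ` S \<Longrightarrow> L x (c *s v) = c * L x v"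
    using assms by (metis holo_onE)
  have "(?T has_derivative (\<lambda>v. A *v v)) (at x within S)" for x
    by (auto intro!: derivative_eq_intros bounded_linear.has_derivative[OF bounded_linear_matrix_vector_mult])
  from has_derivative_in_compose[OF this L(1)] show ?thesis
    by (rule holo_onI) (auto simp: L(2) vector_scalar_commute)
qed

lemma holo_on_imp_holomorphic_on_line:
  assumes hol: "holo_on S f" and S: "open S"
  shows "(\<lambda>w. f (w *s z)) holomorphic_on {w. w *s z \<in> S}"
proof (rule holomorphic_onI)
  fix w assume "w \<in> {w. w *s z \<in> S}"
  then have w: "w *s z \<in> S" by simp
  then obtain L where L: "(f has_derivative L) (at (w *s z))" and lin: "\<And>c v. L (c *s v) = c * L v"
    using hol[unfolded holo_on_def, rule_format, OF w] at_within_open[OF w S] by metis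
  have "((\<lambda>w. w *s z) has_derivative (\<lambda>h. h *s z)) (at w)"
    using has_derivative_vector_smult[OF has_derivative_ident has_derivative_const] by simp
  from has_derivative_compose[OF this L]
  have "((\<lambda>w. f (w *s z)) has_field_derivative L z) (at w)"
    unfolding has_field_derivative_def lin mult.commute[of _ "L z"] .
  then show "(\<lambda>w. f (w *s z)) field_differentiable at w within {w. w *s z \<in> S}"
    using field_differentiable_at_within field_differentiable_def by blast
qed

section \<open>The mean value inequality on balanced sets\<close>

lemma holomorphic_circle_mean:
  assumes contf: "continuous_on (cball 0 1) h" and holf: "h holomorphic_on ball 0 1"
  shows "((\<lambda>t. h (cis (2 * pi * t))) has_integral h 0) {0..1}"
proof -
  define c where "c = 2 * of_real pi * \<i>"
  have "c \<noteq> 0" by (simp add: c_def)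
  have "((\<lambda>u. h u / (u - 0)) has_contour_integral c * h 0) (circlepath 0 1)"
    unfolding c_def by (rule Cauchy_integral_circlepath[OF assms]) simp
  then have "((\<lambda>t. c * h (cis (2 * pi * t))) has_integral c * h 0) {0..1}"
    unfolding has_contour_integral_def
    by (rule has_integral_eq[rotated])
       (simp add: vector_derivative_circlepath01, simp add: circlepath cis_conv_exp c_def mult_ac)
  from has_integral_mult_right[OF this, of "inverse c"] show ?thesis
    using \<open>c \<noteq> 0\<close> by (simp flip: mult.assoc)
qed

lemma norm_le_nn_integral_circle:
  assumes contf: "continuous_on (cball 0 1) h" and holf: "h holomorphic_on ball 0 1"
  shows "ennreal (cmod (h 0)) \<le> (\<integral>\<^sup>+ t\<in>{0..1}. ennreal (cmod (h (cis (2 * pi * t)))) \<partial>lborel)"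
proof -
  let ?u = "\<lambda>t. h (cis (2 * pi * t))"
  have "continuous_on {0..1} ?u"
    by (intro continuous_on_compose2[OF contf] continuous_intros) auto
  then have integrable: "set_integrable lborel {0..1} ?u"
    unfolding set_integrable_def by (intro borel_integrable_compact) auto
  have "h 0 = (LINT t:{0..1}|lborel. ?u t)"
    using holomorphic_circle_mean[OF assms] set_borel_integral_eq_integral(2)[OF integrable]
    by (simp add: integral_unique)
  then show ?thesis
    using integral_norm_bound_ennreal[OF integrable[unfolded set_integrable_def]]
    by (simp add: set_lebesgue_integral_def ennreal_mult'' mult.commute ennreal_indicator)
qed

definition balanced :: "(complex^'n) set \<Rightarrow> bool" where
  "balanced P \<longleftrightarrow> (\<forall>c z. cmod c \<le> 1 \<longrightarrow> z \<in> P \<longrightarrow> c *s z \<in> P)"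

lemma balancedD: "balanced P \<Longrightarrow> z \<in> P \<Longrightarrow> cmod c \<le> 1 \<Longrightarrow> c *s z \<in> P"
  by (simp add: balanced_def)

lemma balanced_rotate_iff:
  assumes "balanced P" "cmod c = 1"
  shows "c *s z \<in> P \<longleftrightarrow> z \<in> P"
proof
  assume "c *s z \<in> P"
  then have "inverse c *s (c *s z) \<in> P"
    by (rule balancedD[OF assms(1)]) (simp add: norm_inverse assms(2))
  moreover have "inverse c *s (c *s z) = z"
    using assms(2) by (cases "c = 0") (simp_all add: vec_eq_iff flip: mult.assoc)
  ultimately show "z \<in> P" by (simp only:)
qed (simp add: balancedD assms)

lemma norm_le_nn_integral_rotations:
  fixes P :: "(complex^'n) set"
  assumes P: "open P" "balanced P" and hol: "holo_on P g" and z: "z \<in> P" and "0 \<le> c"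
  shows "ennreal (cmod (g 0) * c) \<le> (\<integral>\<^sup>+ t\<in>{0..1}. ennreal (cmod (g (cis (2 * pi * t) *s z)) * c) \<partial>lborel)"
proof -
  define h where "h w = g (w *s z) * of_real c" for w
  have "cball 0 1 \<subseteq> {w. w *s z \<in> P}"
    using P(2) z by (auto simp: balanced_def)
  then have "(\<lambda>w. g (w *s z)) holomorphic_on cball 0 1"
    using holomorphic_on_subset[OF holo_on_imp_holomorphic_on_line[OF hol P(1)]] by blast
  then have "h holomorphic_on cball 0 1"
    unfolding h_def by (intro holomorphic_intros)
  then have "ennreal (cmod (h 0)) \<le> (\<integral>\<^sup>+ t\<in>{0..1}. ennreal (cmod (h (cis (2 * pi * t)))) \<partial>lborel)"
    by (intro norm_le_nn_integral_circle holomorphic_on_imp_continuous_on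
        holomorphic_on_subset[OF _ ball_subset_cball])
  then show ?thesis using \<open>0 \<le> c\<close> by (simp add: h_def norm_mult)
qed

lemma balanced_mean_value_inequality:
  fixes P :: "(complex^'n) set"
  assumes P: "open P" "balanced P" and hol: "holo_on P g"
    and W: "continuous_on P W" "\<And>z. z \<in> P \<Longrightarrow> 0 \<le> W z"
    and rotate: "\<And>c z. cmod c = 1 \<Longrightarrow> W (c *s z) = W z"
  shows "(\<integral>\<^sup>+ z\<in>P. ennreal (cmod (g 0) * W z) \<partial>lborel) \<le> (\<integral>\<^sup>+ z\<in>P. ennreal (cmod (g z) * W z) \<partial>lborel)"
proof -
  define G where "G z = ennreal (cmod (g z) * W z) * indicator P z" for z
  define \<omega> where "\<omega> t = cis (2 * pi * t)" for t
  have norm_\<omega>: "cmod (\<omega> t) = 1" for t by (simp add: \<omega>_def)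
  have [measurable]: "G \<in> borel_measurable borel"
    unfolding G_def using P(1)
    by (intro borel_measurable_ennreal_continuous_indicator continuous_intros holo_on_imp_continuous_on[OF hol] W)
       simp
  have [measurable]: "(\<lambda>(t, z::complex^'n). \<omega> t *s z) \<in> borel_measurable (borel \<Otimes>\<^sub>M borel)"
    unfolding borel_prod \<omega>_def split_beta by (intro borel_measurable_continuous_onI continuous_intros)
  have "ennreal (cmod (g 0) * W z) * indicator P z \<le> (\<integral>\<^sup>+ t\<in>{0..1}. G (\<omega> t *s z) \<partial>lborel)" for z
  proof (cases "z \<in> P")
    case True
    then have "G (\<omega> t *s z) = ennreal (cmod (g (\<omega> t *s z)) * W z)" for t
      by (simp add: G_def rotate norm_\<omega> balanced_rotate_iff[OF P(2)])
    then show ?thesis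
      using norm_le_nn_integral_rotations[OF P hol True W(2)[OF True]] True by (simp add: \<omega>_def)
  qed simp
  then have "(\<integral>\<^sup>+ z\<in>P. ennreal (cmod (g 0) * W z) \<partial>lborel)
      \<le> (\<integral>\<^sup>+ z. (\<integral>\<^sup>+ t\<in>{0..1}. G (\<omega> t *s z) \<partial>lborel) \<partial>lborel)"
    by (rule nn_integral_mono)
  also have "\<dots> = (\<integral>\<^sup>+ t. \<integral>\<^sup>+ z. G (\<omega> t *s z) * indicator {0..1} t \<partial>lborel \<partial>lborel)"
    by (rule lborel_pair.Fubini') measurable
  also have "\<dots> = (\<integral>\<^sup>+ t\<in>{0..1::real}. integral\<^sup>N lborel G \<partial>lborel)"
    by (simp add: nn_integral_multc
        nn_integral_lborel_orthogonal[OF orthogonal_transformation_vector_smult[OF norm_\<omega>]])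
  also have "\<dots> = integral\<^sup>N lborel G"
    by (simp add: nn_integral_cmult_indicator)
  finally show ?thesis unfolding G_def .
qed

lemma balanced_mean_square_inequality:
  fixes P :: "(complex^'n) set"
  assumes P: "open P" "balanced P" and hol: "holo_on P g" and W: "continuous_on P W"
    and rotate: "\<And>c z. cmod c = 1 \<Longrightarrow> W (c *s z) = W z"
  shows "(\<integral>\<^sup>+ z\<in>P. ennreal ((cmod (g 0))\<^sup>2 * exp (- W z)) \<partial>lborel)
    \<le> (\<integral>\<^sup>+ z\<in>P. ennreal ((cmod (g z))\<^sup>2 * exp (- W z)) \<partial>lborel)"
proof -
  have "continuous_on P (\<lambda>z. exp (- W z))" by (intro continuous_intros W)
  then show ?thesis
    using balanced_mean_value_inequality[OF P holo_on_mult[OF hol hol], of "\<lambda>z. exp (- W z)"] rotate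
    by (simp add: norm_mult power2_eq_square)
qed

section \<open>Unitary matrices\<close>

definition cinner :: "complex^'n \<Rightarrow> complex^'n \<Rightarrow> complex" where
  "cinner w z = (\<Sum>i\<in>UNIV. cnj (w $ i) * z $ i)"

definition cadj :: "complex^'n^'m \<Rightarrow> complex^'m^'n" where
  "cadj A = (\<chi> i j. cnj (A $ j $ i))"

lemma cinner_diff_right: "cinner w (y - z) = cinner w y - cinner w z"
  by (simp add: cinner_def right_diff_distrib sum_subtractf)

lemma cinner_smult_right: "cinner w (c *s z) = c * cinner w z"
  by (simp add: cinner_def sum_distrib_left mult_ac)

lemma cinner_self: "cinner z z = of_real ((norm z)\<^sup>2)"
proof -
  have "cinner z z = (\<Sum>i\<in>UNIV. of_real ((cmod (z $ i))\<^sup>2))"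
    unfolding cinner_def complex_norm_square by (simp only: mult.commute)
  then show ?thesis by (simp add: norm_vec_def L2_set_def sum_nonneg)
qed

lemma cinner_cadj: "cinner (A *v v) w = cinner v (cadj A *v w)"
proof -
  have "cinner (A *v v) w = (\<Sum>i\<in>UNIV. \<Sum>j\<in>UNIV. cnj (v $ j) * (cnj (A $ i $ j) * w $ i))"
    by (simp add: cinner_def matrix_vector_mult_def sum_distrib_right sum_distrib_left mult_ac)
  also have "\<dots> = cinner v (cadj A *v w)"
    by (subst sum.swap) (simp add: cinner_def cadj_def matrix_vector_mult_def sum_distrib_left)
  finally show ?thesis .
qed

lemma unitary_iff_cadj: "unitary A \<longleftrightarrow> cadj A ** A = mat 1"
  by (simp add: unitary_def cadj_def)

lemma
  assumes "unitary A"
  shows cadj_mult_unitary: "cadj A *v (A *v z) = z"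
    and unitary_mult_cadj: "A *v (cadj A *v z) = z"
proof -
  have "cadj A ** A = mat 1" "A ** cadj A = mat 1"
    using assms matrix_left_right_inverse by (auto simp: unitary_iff_cadj)
  then show "cadj A *v (A *v z) = z" "A *v (cadj A *v z) = z"
    by (simp_all add: matrix_vector_mul_assoc)
qed

lemma norm_unitary:
  assumes "unitary A"
  shows "norm (A *v z) = norm z"
proof -
  have "of_real ((norm (A *v z))\<^sup>2) = (of_real ((norm z)\<^sup>2) :: complex)"
    unfolding cinner_self[symmetric] cinner_cadj cadj_mult_unitary[OF assms] ..
  then show ?thesis unfolding of_real_eq_iff by simp
qed

lemma orthogonal_transformation_unitary: "unitary A \<Longrightarrow> orthogonal_transformation (\<lambda>z. A *v z)"
  by (simp add: orthogonal_transformation norm_unitary bounded_linear.linear[OF bounded_linear_matrix_vector_mult])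

lemma holo_on_unitary_iff:
  assumes A: "unitary A"
  shows "holo_on ((\<lambda>z. a + A *v z) ` P) f \<longleftrightarrow> holo_on P (\<lambda>z. f (a + A *v z))"
proof
  let ?\<Phi> = "\<lambda>z. a + A *v z" and ?\<Psi> = "\<lambda>x. - (cadj A *v a) + cadj A *v x"
  have inv: "?\<Psi> (?\<Phi> z) = z" "?\<Phi> (?\<Psi> x) = x" for z x
    by (simp_all add: matrix_vector_right_distrib matrix_vector_mult_diff_distrib
        cadj_mult_unitary[OF A] unitary_mult_cadj[OF A])
  assume "holo_on P (\<lambda>z. f (?\<Phi> z))"
  moreover have "P = ?\<Psi> ` ?\<Phi> ` P" unfolding image_image inv by simp
  ultimately have "holo_on (?\<Phi> ` P) (\<lambda>x. f (?\<Phi> (?\<Psi> x)))"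
    by (intro holo_on_compose_affine[where f = "\<lambda>z. f (?\<Phi> z)"]) simp
  then show "holo_on (?\<Phi> ` P) f" unfolding inv .
qed (rule holo_on_compose_affine)

definition householder :: "complex^'n \<Rightarrow> complex^'n^'n" where
  "householder w = (\<chi> i j. (if i = j then 1 else 0) - 2 * w $ i * cnj (w $ j) / of_real ((norm w)\<^sup>2))"

lemma householder_mult_vector:
  "householder w *v z = z - (2 * cinner w z / of_real ((norm w)\<^sup>2)) *s w"
proof -
  define c where "c = 2 / complex_of_real ((norm w)\<^sup>2)"
  have "(householder w *v z) $ i = (z - (c * cinner w z) *s w) $ i" for i
  proof -
    have "(householder w *v z) $ i = (\<Sum>j\<in>UNIV. (if j = i then z $ i else 0) - c * w $ i * (cnj (w $ j) * z $ j))"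
      unfolding matrix_vector_mult_def householder_def c_def
      by (simp, intro sum.cong refl) (simp add: left_diff_distrib)
    also have "\<dots> = z $ i - c * w $ i * cinner w z"
      by (simp add: sum_subtractf cinner_def flip: sum_distrib_left)
    finally show ?thesis by simp
  qed
  then show ?thesis by (simp add: vec_eq_iff c_def)
qed

lemma unitary_householder: "unitary (householder w)"
proof (cases "w = 0")
  case False
  have "cinner w (householder w *v z) = - cinner w z" for z
    using False by (simp add: householder_mult_vector cinner_diff_right cinner_smult_right cinner_self)
  then have "householder w *v (householder w *v z) = z" for z
    by (subst householder_mult_vector) (simp add: householder_mult_vector vec_eq_iff)
  then have "householder w ** householder w = mat 1"
    by (simp add: matrix_eq flip: matrix_vector_mul_assoc)
  moreover have "cadj (householder w) = householder w"
    by (simp add: cadj_def householder_def vec_eq_iff)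
  ultimately show ?thesis by (simp add: unitary_iff_cadj)
next
  case True
  then have "householder w = mat 1" "cadj (mat 1 :: complex^'n^'n) = mat 1"
    by (auto simp: householder_def cadj_def mat_def vec_eq_iff)
  then show ?thesis by (simp add: unitary_iff_cadj)
qed

lemma householder_diff_mult_vector:
  assumes "norm u = norm v" and real: "cnj (cinner u v) = cinner u v"
  shows "householder (u - v) *v v = u"
proof -
  let ?w = "u - v" and ?N = "complex_of_real ((norm (u - v))\<^sup>2)"
  have cinner_diff_left: "cinner ?w z = cinner u z - cinner v z" for z
    by (simp add: cinner_def left_diff_distrib sum_subtractf)
  have "cinner v u = cnj (cinner u v)" by (simp add: cinner_def mult.commute)
  with real have commute: "cinner v u = cinner u v" by (rule trans[rotated])
  have "?N = cinner ?w u - cinner ?w v"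
    by (simp only: cinner_self[symmetric] cinner_diff_right)
  also have "\<dots> = - (2 * cinner ?w v)"
    using assms(1) by (simp add: cinner_diff_left cinner_self commute)
  finally have N: "2 * cinner ?w v = - ?N" by simp
  show ?thesis
    unfolding householder_mult_vector N by (cases "u = v") (simp_all add: vec_eq_iff)
qed

abbreviation first_axis :: "complex^'n" where
  "first_axis \<equiv> axis first_idx 1"

lemma ex_unitary_mult_first_axis:
  fixes u :: "complex^'n"
  assumes "u \<noteq> 0"
  obtains A c where "unitary A" "c \<noteq> 0" "A *v first_axis = c *s u"
proof -
  define p where "p = u $ first_idx"
  define c where "c = (if p = 0 then 1 else cnj p / of_real (cmod p)) / of_real (norm u)"
  have norm: "norm (c *s u) = norm (first_axis :: complex^'n)" and "c \<noteq> 0"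
    using assms by (auto simp: c_def norm_vector_smult norm_divide norm_axis_1)
  have "c * p = of_real (cmod p / norm u)"
    by (simp add: c_def complex_norm_square[symmetric] power2_eq_square mult.commute)
  moreover have "cinner (c *s u) first_axis = cnj (c * p)"
    by (simp add: cinner_def p_def axis_def if_distrib cong: if_cong)
  ultimately have "cnj (cinner (c *s u) first_axis) = cinner (c *s u) first_axis" by simp
  then have "householder (c *s u - first_axis) *v first_axis = c *s u"
    by (rule householder_diff_mult_vector[OF norm])
  with unitary_householder \<open>c \<noteq> 0\<close> show thesis by (rule that)
qed

section \<open>Extensions from a point\<close>

definition optimal_extension ::
    "(complex^'n \<Rightarrow> real) \<Rightarrow> complex^'n \<Rightarrow> (complex^'n) set \<Rightarrow> (complex^'n \<Rightarrow> complex) \<Rightarrow> bool" where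
  "optimal_extension \<phi> a P f \<longleftrightarrow> holo_on ((\<lambda>z. a + z) ` P) f \<and>
            (\<forall>x. x \<notin> (\<lambda>z. a + z) ` P \<longrightarrow> f x = 0) \<and>
            f a = 1 \<and>
            (\<integral>\<^sup>+ x \<in> (\<lambda>z. a + z) ` P. ennreal ((cmod (f x))\<^sup>2 * exp (- \<phi> x)) \<partial>lebesgue)
              \<le> emeasure lebesgue P * ennreal (exp (- \<phi> a))"

text \<open>The same notion after an affine change of coordinates and division by \<open>exp (- \<phi> a)\<close>, so that \<open>a = 0\<close>
  and the weight vanishes there.\<close>
definition normalized_extension :: "(complex^'n \<Rightarrow> real) \<Rightarrow> (complex^'n) set \<Rightarrow> (complex^'n \<Rightarrow> complex) \<Rightarrow> bool" where
  "normalized_extension \<psi> P g \<longleftrightarrow> holo_on P g \<and> (\<forall>z. z \<notin> P \<longrightarrow> g z = 0) \<and> g 0 = 1 \<and>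
     (\<integral>\<^sup>+ z\<in>P. ennreal ((cmod (g z))\<^sup>2 * exp (- \<psi> z)) \<partial>lborel) \<le> emeasure lborel P"

lemma normalized_extensionD:
  assumes "normalized_extension \<psi> P g"
  shows "holo_on P g" "z \<notin> P \<Longrightarrow> g z = 0" "g 0 = 1"
    "(\<integral>\<^sup>+ z\<in>P. ennreal ((cmod (g z))\<^sup>2 * exp (- \<psi> z)) \<partial>lborel) \<le> emeasure lborel P"
  using assms by (auto simp: normalized_extension_def)

lemma ex1_bij_iff:
  assumes "bij T" and "\<And>x. P x \<longleftrightarrow> Q (T x)"
  shows "(\<exists>!x. P x) \<longleftrightarrow> (\<exists>!y. Q y)"
  using assms by (metis bij_pointE)

lemma weighted_integral_unitary_image:
  assumes A: "unitary A" and P: "open P" and \<phi>: "continuous_on ((\<lambda>z. a + A *v z) ` P) \<phi>"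
    and f: "holo_on ((\<lambda>z. a + A *v z) ` P) f"
  shows "(\<integral>\<^sup>+ x\<in>(\<lambda>z. a + A *v z) ` P. ennreal ((cmod (f x))\<^sup>2 * exp (- \<phi> x)) \<partial>lebesgue)
    = ennreal (exp (- \<phi> a)) *
      (\<integral>\<^sup>+ z\<in>P. ennreal ((cmod (f (a + A *v z)))\<^sup>2 * exp (- (\<phi> (a + A *v z) - \<phi> a))) \<partial>lborel)"
proof -
  let ?\<Phi> = "\<lambda>z. a + A *v z"
  define F where "F x = (cmod (f x))\<^sup>2 * exp (- \<phi> x)" for x
  define G where "G z = (cmod (f (?\<Phi> z)))\<^sup>2 * exp (- (\<phi> (?\<Phi> z) - \<phi> a))" for z
  have FG: "F (?\<Phi> z) = exp (- \<phi> a) * G z" for z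
    by (simp add: F_def G_def mult.left_commute[of "exp (- \<phi> a)"] flip: exp_add)
  have contF: "continuous_on (?\<Phi> ` P) F"
    unfolding F_def by (intro continuous_intros \<phi> holo_on_imp_continuous_on[OF f])
  have cont\<Phi>: "continuous_on P ?\<Phi>"
    by (intro continuous_intros linear_continuous_on bounded_linear_matrix_vector_mult)
  have "continuous_on P G"
    unfolding G_def
    by (intro continuous_intros continuous_on_compose2[OF \<phi> cont\<Phi> subset_refl]
        continuous_on_compose2[OF holo_on_imp_continuous_on[OF f] cont\<Phi> subset_refl])
  then have [measurable]: "(\<lambda>z. ennreal (G z) * indicator P z) \<in> borel_measurable lborel"
    using P by (simp add: borel_measurable_ennreal_continuous_indicator)
  have "(\<integral>\<^sup>+ x\<in>?\<Phi> ` P. ennreal (F x) \<partial>lebesgue) = (\<integral>\<^sup>+ z\<in>P. ennreal (F (?\<Phi> z)) \<partial>lborel)"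
    by (rule set_nn_integral_orthogonal_affine_image[OF orthogonal_transformation_unitary[OF A] P contF])
  also have "\<dots> = ennreal (exp (- \<phi> a)) * (\<integral>\<^sup>+ z\<in>P. ennreal (G z) \<partial>lborel)"
    by (subst nn_integral_cmult[symmetric]) (auto simp: FG ennreal_mult' mult.assoc)
  finally show ?thesis unfolding F_def G_def .
qed

lemma optimal_extension_iff_normalized:
  assumes A: "unitary A" and P: "open P" and \<phi>: "continuous_on ((\<lambda>z. a + A *v z) ` P) \<phi>"
  shows "optimal_extension \<phi> a ((\<lambda>z. A *v z) ` P) f
    \<longleftrightarrow> normalized_extension (\<lambda>z. \<phi> (a + A *v z) - \<phi> a) P (\<lambda>z. f (a + A *v z))"
proof -
  let ?\<Phi> = "\<lambda>z. a + A *v z"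
  have inv: "x = ?\<Phi> (cadj A *v (x - a))" for x
    by (simp add: unitary_mult_cadj[OF A])
  have "inj ?\<Phi>"
    using orthogonal_transformation_inj[OF orthogonal_transformation_unitary[OF A]] by (simp add: inj_def)
  then have support: "(\<forall>x. x \<notin> ?\<Phi> ` P \<longrightarrow> f x = 0) \<longleftrightarrow> (\<forall>z. z \<notin> P \<longrightarrow> f (?\<Phi> z) = 0)"
    by (metis inv inj_image_mem_iff)
  have scale: "c * I \<le> V * c \<longleftrightarrow> I \<le> V" if "c = ennreal (exp t)" for c I V t
    using that by (simp add: mult.commute[of V] ennreal_mult_le_mult_iff)
  show ?thesis
    unfolding optimal_extension_def normalized_extension_def image_image support
      holo_on_unitary_iff[OF A, symmetric]
      emeasure_lebesgue_orthogonal_image[OF orthogonal_transformation_unitary[OF A] P]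
    by (rule conj_cong[OF refl]) (simp add: weighted_integral_unitary_image[OF A P \<phi>] scale)
qed

lemma ex1_optimal_extension_iff_normalized:
  assumes A: "unitary A" and P: "open P" and \<phi>: "continuous_on ((\<lambda>z. a + A *v z) ` P) \<phi>"
  shows "(\<exists>!f. optimal_extension \<phi> a ((\<lambda>z. A *v z) ` P) f)
    \<longleftrightarrow> (\<exists>!g. normalized_extension (\<lambda>z. \<phi> (a + A *v z) - \<phi> a) P g)"
proof (rule ex1_bij_iff)
  show "optimal_extension \<phi> a ((\<lambda>z. A *v z) ` P) f
      \<longleftrightarrow> normalized_extension (\<lambda>z. \<phi> (a + A *v z) - \<phi> a) P (\<lambda>z. f (a + A *v z))" for f
    by (rule optimal_extension_iff_normalized[OF assms])
  show "bij (\<lambda>f z. f (a + A *v z))"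
    by (rule o_bij[of "\<lambda>g x. g (cadj A *v (x - a))"])
       (simp_all add: fun_eq_iff cadj_mult_unitary[OF A] unitary_mult_cadj[OF A])
qed

lemma normalized_extension_gauge:
  assumes g: "normalized_extension \<psi> P g" and q: "holo_on P q" "q 0 = 0"
    and \<psi>: "\<And>z. z \<in> P \<Longrightarrow> \<psi> z = \<psi>' z + Re (q z)"
  shows "normalized_extension \<psi>' P (\<lambda>z. g z * exp (q z * (- 1 / 2)))"
proof -
  have norm_exp: "(cmod (exp (q z * (- 1 / 2))))\<^sup>2 = exp (- Re (q z))" for z
    by (simp add: norm_exp_eq_Re flip: exp_double)
  have pointwise: "(cmod (g z * exp (q z * (- 1 / 2))))\<^sup>2 * exp (- \<psi>' z) = (cmod (g z))\<^sup>2 * exp (- \<psi> z)"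
    if "z \<in> P" for z
    unfolding norm_mult power_mult_distrib norm_exp \<psi>[OF that] mult.assoc by (simp flip: exp_add)
  have "(\<integral>\<^sup>+ z\<in>P. ennreal ((cmod (g z * exp (q z * (- 1 / 2))))\<^sup>2 * exp (- \<psi>' z)) \<partial>lborel)
      = (\<integral>\<^sup>+ z\<in>P. ennreal ((cmod (g z))\<^sup>2 * exp (- \<psi> z)) \<partial>lborel)"
    by (rule set_nn_integral_cong) (simp_all only: pointwise Int_iff)
  moreover have "holo_on P (\<lambda>z. g z * exp (q z * (- 1 / 2)))"
    by (intro holo_on_mult holo_on_exp holo_on_const q normalized_extensionD(1)[OF g])
  moreover have "g 0 * exp (q 0 * (- 1 / 2)) = 1" "\<And>z. z \<notin> P \<Longrightarrow> g z * exp (q z * (- 1 / 2)) = 0"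
    using normalized_extensionD(2,3)[OF g] q(2) by simp_all
  ultimately show ?thesis
    using normalized_extensionD(4)[OF g] unfolding normalized_extension_def by presburger
qed

lemma ex1_normalized_extension_gauge:
  assumes q: "holo_on P q" "q 0 = 0" and \<psi>: "\<And>z. z \<in> P \<Longrightarrow> \<psi> z = \<psi>' z + Re (q z)"
  shows "(\<exists>!g. normalized_extension \<psi> P g) \<longleftrightarrow> (\<exists>!g. normalized_extension \<psi>' P g)"
proof (rule ex1_bij_iff)
  let ?T = "\<lambda>p g z. g z * exp (p z * (- 1 / 2)) :: complex"
  have inv: "?T (\<lambda>z. q z * (- 1)) (?T q g) = g" "?T q (?T (\<lambda>z. q z * (- 1)) g) = g" for g
    by (simp_all add: fun_eq_iff exp_minus)
  show "bij (?T q)"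
    by (rule o_bij[of "?T (\<lambda>z. q z * (- 1))"]) (simp_all add: fun_eq_iff exp_minus)
  show "normalized_extension \<psi> P g \<longleftrightarrow> normalized_extension \<psi>' P (?T q g)" for g
  proof
    assume "normalized_extension \<psi>' P (?T q g)"
    then have "normalized_extension \<psi> P (?T (\<lambda>z. q z * (- 1)) (?T q g))"
    proof (rule normalized_extension_gauge)
      show "holo_on P (\<lambda>z. q z * (- 1))" by (intro holo_on_mult holo_on_const q)
    qed (simp_all add: q \<psi>)
    then show "normalized_extension \<psi> P g" unfolding inv .
  qed (rule normalized_extension_gauge[OF _ assms])
qed

text \<open>Otherwise, by the parallelogram law, the midpoint of \<open>g\<close> and \<open>1\<close> would violate the mean value inequality.\<close>
lemma normalized_extension_0_imp_eq_1:
  assumes P: "open P" "balanced P" "emeasure lborel P < \<infinity>"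
    and g: "normalized_extension (\<lambda>_. 0) P g" and z: "z \<in> P"
  shows "g z = 1"
proof -
  define k where "k z = (g z + 1) * (1 / 2)" for z
  note hol = normalized_extensionD(1)[OF g]
  have hol_k: "holo_on P k"
    unfolding k_def by (intro holo_on_mult holo_on_add holo_on_const hol)
  have [measurable]: "P \<in> sets borel" using P(1) by simp
  note cont = holo_on_imp_continuous_on[OF hol] holo_on_imp_continuous_on[OF hol_k]
  define K where "K z = ennreal ((cmod (k z))\<^sup>2) * indicator P z" for z
  define D where "D z = ennreal ((cmod (g z - 1))\<^sup>2) * indicator P z" for z
  define G where "G z = ennreal ((cmod (g z))\<^sup>2) * indicator P z" for z
  have [measurable]: "K \<in> borel_measurable borel" "D \<in> borel_measurable borel" "G \<in> borel_measurable borel"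
    unfolding K_def D_def G_def
    by (intro borel_measurable_ennreal_continuous_indicator continuous_intros cont; simp)+
  have "4 * (cmod (k z))\<^sup>2 + (cmod (g z - 1))\<^sup>2 = 2 * (cmod (g z))\<^sup>2 + 2" for z
    by (simp add: k_def cmod_power2 norm_mult norm_divide power_divide) (simp add: power2_eq_square field_simps)
  from arg_cong[OF this, of ennreal] have parallelogram: "4 * K z + D z = 2 * G z + 2 * indicator P z" for z
    by (simp add: K_def D_def G_def indicator_def ennreal_mult)
  have "emeasure lborel P \<le> (\<integral>\<^sup>+ z. K z \<partial>lborel)"
    using balanced_mean_square_inequality[OF P(1,2) hol_k, of "\<lambda>_. 0"] normalized_extensionD(3)[OF g]
    by (simp add: K_def k_def)
  then have "4 * emeasure lborel P + (\<integral>\<^sup>+ z. D z \<partial>lborel) \<le> 4 * (\<integral>\<^sup>+ z. K z \<partial>lborel) + (\<integral>\<^sup>+ z. D z \<partial>lborel)"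
    by (intro add_right_mono mult_left_mono) auto
  also have "\<dots> = (\<integral>\<^sup>+ z. 4 * K z + D z \<partial>lborel)"
    by (simp add: nn_integral_add nn_integral_cmult)
  also have "\<dots> = 2 * (\<integral>\<^sup>+ z. G z \<partial>lborel) + 2 * emeasure lborel P"
    unfolding parallelogram by (simp add: nn_integral_add nn_integral_cmult)
  also have "\<dots> \<le> 2 * emeasure lborel P + 2 * emeasure lborel P"
    using normalized_extensionD(4)[OF g] by (intro add_right_mono mult_left_mono) (auto simp: G_def)
  also have "\<dots> = 4 * emeasure lborel P + 0" by (simp flip: distrib_right)
  finally have "(\<integral>\<^sup>+ z. D z \<partial>lborel) = 0"
    using P(3) by (subst (asm) ennreal_add_left_cancel_le) (auto simp: ennreal_mult_eq_top_iff)
  moreover have "continuous_on P (\<lambda>z. (cmod (g z - 1))\<^sup>2)" by (intro continuous_intros cont)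
  ultimately show ?thesis
    using open_continuous_set_nn_integral_eq_0[OF P(1) _ _ _ z, of "\<lambda>z. (cmod (g z - 1))\<^sup>2"]
    by (simp add: D_def)
qed

lemma ex1_normalized_extension_0:
  assumes P: "open P" "balanced P" "emeasure lborel P < \<infinity>" and "0 \<in> P"
  shows "\<exists>!g. normalized_extension (\<lambda>_. 0) P g"
proof
  let ?one = "\<lambda>z. if z \<in> P then 1 else 0 :: complex"
  have "(\<integral>\<^sup>+ z\<in>P. ennreal ((cmod (?one z))\<^sup>2 * exp (- 0)) \<partial>lborel) = (\<integral>\<^sup>+ z. indicator P z \<partial>lborel)"
    by (intro nn_integral_cong) (simp add: indicator_def)
  moreover have "holo_on P ?one"
    using holo_on_const[of P 1] by (rule holo_on_cong[THEN iffD1, rotated]) simp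
  ultimately show "normalized_extension (\<lambda>_. 0) P ?one"
    using assms by (simp add: normalized_extension_def)
next
  fix g assume g: "normalized_extension (\<lambda>_. 0) P g"
  show "g = (\<lambda>z. if z \<in> P then 1 else 0)"
    using normalized_extension_0_imp_eq_1[OF P g] normalized_extensionD(2)[OF g] by auto
qed

lemma normalized_extension_imp_mean_le:
  assumes P: "open P" "balanced P" and g: "normalized_extension \<psi> P g"
    and W: "continuous_on P W" "\<And>c z. cmod c = 1 \<Longrightarrow> W (c *s z) = W z" "\<And>z. z \<in> P \<Longrightarrow> \<psi> z \<le> W z"
  shows "(\<integral>\<^sup>+ z\<in>P. ennreal (exp (- W z)) \<partial>lborel) \<le> emeasure lborel P"
proof -
  have "(\<integral>\<^sup>+ z\<in>P. ennreal (exp (- W z)) \<partial>lborel)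
      \<le> (\<integral>\<^sup>+ z\<in>P. ennreal ((cmod (g z))\<^sup>2 * exp (- W z)) \<partial>lborel)"
    using balanced_mean_square_inequality[OF P normalized_extensionD(1)[OF g] W(1,2)]
      normalized_extensionD(3)[OF g] by simp
  also have "\<dots> \<le> (\<integral>\<^sup>+ z\<in>P. ennreal ((cmod (g z))\<^sup>2 * exp (- \<psi> z)) \<partial>lborel)"
    using W(3) by (intro nn_integral_mono) (auto simp: indicator_def intro!: ennreal_leI mult_left_mono)
  finally show ?thesis using normalized_extensionD(4)[OF g] by simp
qed

lemma normalized_extension_bounded:
  fixes P :: "(complex^'n) set"
  assumes P: "open P" "0 \<in> P" and \<psi>: "continuous_on P \<psi>"
    and g: "holo_on P g" "g 0 = 1" "\<And>z. z \<in> P \<Longrightarrow> cmod (g z) \<le> C"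
    and mass_le: "ennreal (C\<^sup>2) * (\<integral>\<^sup>+ z\<in>P. ennreal (exp (- \<psi> z)) \<partial>lborel) \<le> emeasure lborel P"
  shows "normalized_extension \<psi> P (\<lambda>z. if z \<in> P then g z else 0)"
proof -
  have "(\<integral>\<^sup>+ z\<in>P. ennreal ((cmod (if z \<in> P then g z else 0))\<^sup>2 * exp (- \<psi> z)) \<partial>lborel)
      \<le> (\<integral>\<^sup>+ z. ennreal (C\<^sup>2) * (ennreal (exp (- \<psi> z)) * indicator P z) \<partial>lborel)"
  proof (rule nn_integral_mono)
    fix z
    have "ennreal ((cmod (g z))\<^sup>2 * exp (- \<psi> z)) \<le> ennreal (C\<^sup>2) * ennreal (exp (- \<psi> z))" if "z \<in> P"
      unfolding ennreal_mult'[symmetric, OF exp_ge_zero] ennreal_mult''[symmetric, OF exp_ge_zero]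
      by (intro ennreal_leI mult_right_mono power_mono g(3)[OF that]) auto
    then show "ennreal ((cmod (if z \<in> P then g z else 0))\<^sup>2 * exp (- \<psi> z)) * indicator P z
        \<le> ennreal (C\<^sup>2) * (ennreal (exp (- \<psi> z)) * indicator P z)"
      by (simp add: indicator_def)
  qed
  also have "\<dots> = ennreal (C\<^sup>2) * (\<integral>\<^sup>+ z\<in>P. ennreal (exp (- \<psi> z)) \<partial>lborel)"
  proof (rule nn_integral_cmult)
    show "(\<lambda>z. ennreal (exp (- \<psi> z)) * indicator P z) \<in> borel_measurable lborel"
      using P(1) by (simp add: borel_measurable_ennreal_continuous_indicator continuous_intros \<psi>)
  qed
  also note mass_le
  finally show ?thesis
    using P(2) g(2) holo_on_cong[THEN iffD1, OF _ g(1), of "\<lambda>z. if z \<in> P then g z else 0"]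
    by (simp add: normalized_extension_def)
qed

lemma ex_pos_scaled_less_ennreal:
  fixes I E :: ennreal
  assumes "I < E"
  obtains \<epsilon> where "0 < \<epsilon>" "ennreal ((1 + \<epsilon> * k)\<^sup>2) * I < E"
proof -
  have "((\<lambda>\<epsilon>. ennreal ((1 + \<epsilon> * k)\<^sup>2) * I) \<longlongrightarrow> ennreal ((1 + 0 * k)\<^sup>2) * I) (at_right 0)"
    using assms by (intro tendsto_intros) auto
  then have "\<forall>\<^sub>F \<epsilon> in at_right 0. ennreal ((1 + \<epsilon> * k)\<^sup>2) * I < E"
    by (rule order_tendstoD) (use assms in simp)
  then have "\<forall>\<^sub>F \<epsilon> in at_right 0. 0 < \<epsilon> \<and> ennreal ((1 + \<epsilon> * k)\<^sup>2) * I < E"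
    using eventually_at_right_less[of "0 :: real"] by (simp add: eventually_conj)
  then show thesis
    using that eventually_happens' trivial_limit_at_right_real by blast
qed

text \<open>If \<open>1\<close> satisfied the bound strictly, so would \<open>1 + \<epsilon> z\<^sub>j\<close> for small \<open>\<epsilon>\<close>.\<close>
lemma ex1_normalized_extension_imp_mean_ge:
  fixes P :: "(complex^'n) set"
  assumes P: "open P" "bounded P" "0 \<in> P" and \<psi>: "continuous_on P \<psi>"
    and ex1: "\<exists>!g. normalized_extension \<psi> P g"
  shows "emeasure lborel P \<le> (\<integral>\<^sup>+ z\<in>P. ennreal (exp (- \<psi> z)) \<partial>lborel)"
proof (rule ccontr)
  let ?I = "\<integral>\<^sup>+ z\<in>P. ennreal (exp (- \<psi> z)) \<partial>lborel"
  assume "\<not> ?thesis"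
  then have less: "?I < emeasure lborel P" by simp
  obtain k where k: "\<And>z. z \<in> P \<Longrightarrow> norm z \<le> k"
    using P(2) bounded_pos by blast
  obtain \<epsilon> where \<epsilon>: "\<epsilon> > 0" "ennreal ((1 + \<epsilon> * k)\<^sup>2) * ?I < emeasure lborel P"
    using ex_pos_scaled_less_ennreal[OF less] by blast
  fix j :: 'n
  define g where "g t z = (if z \<in> P then 1 + of_real t * z $ j else 0)" for t z
  have "normalized_extension \<psi> P (g t)" if t: "t \<in> {0, \<epsilon>}" for t
    unfolding g_def
  proof (rule normalized_extension_bounded[OF P(1,3) \<psi>])
    show "holo_on P (\<lambda>z. 1 + of_real t * z $ j)"
      by (intro holo_on_add holo_on_mult holo_on_const holo_on_component)
    show "cmod (1 + of_real t * z $ j) \<le> 1 + t * k" if "z \<in> P" for z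
    proof -
      have "cmod (1 + of_real t * z $ j) \<le> 1 + t * cmod (z $ j)"
        using norm_triangle_ineq[of 1 "of_real t * z $ j"] t \<epsilon>(1) by (auto simp: norm_mult)
      also have "\<dots> \<le> 1 + t * k"
        using t \<epsilon>(1) order_trans[OF Finite_Cartesian_Product.norm_nth_le k[OF that], of j]
        by (intro add_left_mono mult_left_mono) auto
      finally show ?thesis .
    qed
  qed (use t \<epsilon>(2) less in auto)
  then have g_eq: "g 0 = g \<epsilon>" using ex1 by blast
  have zero: "z $ j = 0" if "z \<in> P" for z
    using that \<epsilon>(1) fun_cong[OF g_eq, of z] by (simp add: g_def)
  obtain t where "t > 0" "cball 0 t \<subseteq> P"
    using P(1,3) open_contains_cball by blast
  then have "t *\<^sub>R axis j 1 \<in> P"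
    by (auto simp: norm_axis_1)
  from zero[OF this] show False using \<open>t > 0\<close> by simp
qed

section \<open>Gradients and second derivatives\<close>

lemma GDERIV_along_line:
  assumes "GDERIV f (a + t *\<^sub>R w) :> g"
  shows "((\<lambda>t. f (a + t *\<^sub>R w)) has_real_derivative w \<bullet> g) (at t)"
proof -
  have "((\<lambda>t. a + t *\<^sub>R w) has_derivative (\<lambda>h. h *\<^sub>R w)) (at t)"
    by (auto intro!: derivative_eq_intros)
  from has_derivative_compose[OF this assms[unfolded gderiv_def]] show ?thesis
    by (simp add: has_field_derivative_def mult_commute_abs)
qed

lemma GDERIV_increment_approx:
  fixes f :: "'a::real_inner \<Rightarrow> real"
  assumes G: "\<And>t. 0 \<le> t \<Longrightarrow> t \<le> 1 \<Longrightarrow> GDERIV f (a + t *\<^sub>R w) :> G (a + t *\<^sub>R w)"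
    and bound: "\<And>t. 0 \<le> t \<Longrightarrow> t \<le> 1 \<Longrightarrow> norm (G (a + t *\<^sub>R w) - (u + t *\<^sub>R v)) \<le> B"
  shows "\<bar>f (a + w) - f a - w \<bullet> (u + v /\<^sub>R 2)\<bar> \<le> norm w * B"
proof -
  define p where "p t = f (a + t *\<^sub>R w) - t * (w \<bullet> u) - t\<^sup>2 / 2 * (w \<bullet> v)" for t
  have "(p has_real_derivative w \<bullet> (G (a + t *\<^sub>R w) - (u + t *\<^sub>R v))) (at t)" if "0 \<le> t" "t \<le> 1" for t
    using GDERIV_along_line[OF G[OF that]] unfolding p_def inner_diff_right inner_add_right inner_scaleR_right
    by (auto intro!: derivative_eq_intros)
  from MVT2[OF zero_less_one this] obtain t
    where t: "0 < t" "t < 1" "p 1 - p 0 = w \<bullet> (G (a + t *\<^sub>R w) - (u + t *\<^sub>R v))"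
    by auto
  have "\<bar>p 1 - p 0\<bar> \<le> norm w * norm (G (a + t *\<^sub>R w) - (u + t *\<^sub>R v))"
    unfolding t(3) by (rule Cauchy_Schwarz_ineq2)
  also have "\<dots> \<le> norm w * B"
    using bound t by (intro mult_left_mono) auto
  finally show ?thesis by (simp add: p_def inner_add_right diff_diff_eq)
qed

lemma increment_second_order:
  fixes f :: "'a::real_inner \<Rightarrow> real"
  assumes S: "open S" "x \<in> S" and G: "\<And>y. y \<in> S \<Longrightarrow> GDERIV f y :> G y"
    and H: "(G has_derivative H) (at x)" and e: "0 < e"
  obtains d where "0 < d" "ball x d \<subseteq> S"
    "\<And>z w. norm z + norm w < d \<Longrightarrow>
      \<bar>f (x + z + w) - f (x + z) - w \<bullet> (G x + H z + H w /\<^sub>R 2)\<bar> \<le> e * (norm z + norm w) * norm w"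
proof -
  obtain d1 where d1: "0 < d1" "ball x d1 \<subseteq> S"
    using S open_contains_ball by blast
  obtain d2 where d2: "0 < d2" "\<And>h. norm h < d2 \<Longrightarrow> norm (G (x + h) - G x - H h) \<le> e * norm h"
    using H e unfolding has_derivative_at_alt by (metis add_diff_cancel_left')
  have linH: "linear H" using H by (rule has_derivative_linear)
  have "\<bar>f (x + z + w) - f (x + z) - w \<bullet> (G x + H z + H w /\<^sub>R 2)\<bar> \<le> norm w * (e * (norm z + norm w))"
    if small: "norm z + norm w < min d1 d2" for z w
  proof (rule GDERIV_increment_approx)
    fix t :: real assume t: "0 \<le> t" "t \<le> 1"
    let ?h = "z + t *\<^sub>R w"
    have h: "norm ?h \<le> norm z + norm w"
      using norm_triangle_ineq[of z "t *\<^sub>R w"] mult_left_le_one_le[of "norm w" t] t by simp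
    then have "x + ?h \<in> ball x d1"
      using small unfolding mem_ball dist_norm norm_minus_commute[of x] add_diff_cancel_left' by simp
    then show "GDERIV f (x + z + t *\<^sub>R w) :> G (x + z + t *\<^sub>R w)"
      using G d1(2) unfolding add.assoc by blast
    have "norm (G (x + ?h) - G x - H ?h) \<le> e * (norm z + norm w)"
      using h small e by (intro order_trans[OF d2(2)]) auto
    then show "norm (G (x + z + t *\<^sub>R w) - (G x + H z + t *\<^sub>R H w)) \<le> e * (norm z + norm w)"
      by (simp add: linear_add[OF linH] linear_scale[OF linH] add.assoc diff_diff_eq)
  qed
  with d1 d2(1) show thesis by (intro that[of "min d1 d2"]) (auto simp: mult_ac)
qed

lemma second_difference_approx:
  fixes f :: "'a::real_inner \<Rightarrow> real"
  assumes S: "open S" "x \<in> S" and G: "\<And>y. y \<in> S \<Longrightarrow> GDERIV f y :> G y"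
    and H: "(G has_derivative H) (at x)" and e: "0 < e"
  obtains d where "0 < d"
    "\<And>z w. norm z + norm w < d \<Longrightarrow>
      \<bar>(f (x + z + w) - f (x + z) - f (x + w) + f x) - w \<bullet> H z\<bar> \<le> 2 * (e * (norm z + norm w)\<^sup>2)"
proof -
  obtain d where d: "0 < d" "\<And>z w. norm z + norm w < d \<Longrightarrow>
      \<bar>f (x + z + w) - f (x + z) - w \<bullet> (G x + H z + H w /\<^sub>R 2)\<bar> \<le> e * (norm z + norm w) * norm w"
    using increment_second_order[OF assms] by metis
  have "\<bar>(f (x + z + w) - f (x + z) - f (x + w) + f x) - w \<bullet> H z\<bar> \<le> 2 * (e * (norm z + norm w)\<^sup>2)"
    if small: "norm z + norm w < d" for z w
  proof -
    have "\<bar>(f (x + z + w) - f (x + z) - f (x + w) + f x) - w \<bullet> H z\<bar>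
        \<le> e * (norm z + norm w) * norm w + e * norm w * norm w"
      using d(2)[OF small] d(2)[of 0 w] small norm_ge_zero[of z]
      by (simp add: linear_0[OF has_derivative_linear[OF H]] inner_add_right)
    also have "\<dots> \<le> e * (norm z + norm w) * (norm z + norm w) + e * (norm z + norm w) * (norm z + norm w)"
      using e by (intro add_mono mult_mono mult_left_mono) auto
    finally show ?thesis by (simp add: power2_eq_square)
  qed
  with d(1) show thesis by (rule that)
qed

lemma symmetric_second_derivative:
  fixes f :: "'a::real_inner \<Rightarrow> real"
  assumes S: "open S" "x \<in> S" and G: "\<And>y. y \<in> S \<Longrightarrow> GDERIV f y :> G y"
    and H: "(G has_derivative H) (at x)"
  shows "H u \<bullet> v = H v \<bullet> u"
proof -
  have linH: "linear H" using H by (rule has_derivative_linear)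
  have asymmetry_le: "\<bar>H u \<bullet> v - H v \<bullet> u\<bar> \<le> 4 * (e * (norm u + norm v)\<^sup>2)" if "0 < e" for e
  proof -
    obtain d where d: "0 < d" and second_difference: "\<And>z w. norm z + norm w < d \<Longrightarrow>
        \<bar>(f (x + z + w) - f (x + z) - f (x + w) + f x) - w \<bullet> H z\<bar> \<le> 2 * (e * (norm z + norm w)\<^sup>2)"
      using second_difference_approx[OF assms \<open>0 < e\<close>] by metis
    obtain s where s: "0 < s" "norm (s *\<^sub>R u) + norm (s *\<^sub>R v) < d"
    proof -
      have pos: "0 < norm u + norm v + 1" by (smt (verit) norm_ge_zero)
      define s where "s = d / (norm u + norm v + 1)"
      have "0 < s" using pos d by (simp add: s_def)
      then have "s * (norm u + norm v) < s * (norm u + norm v + 1)" by simp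
      also have "\<dots> = d" using pos by (simp add: s_def)
      finally show thesis using \<open>0 < s\<close> by (intro that[of s]) (simp_all add: distrib_left)
    qed
    have swap: "x + s *\<^sub>R v + s *\<^sub>R u = x + s *\<^sub>R u + s *\<^sub>R v" by simp
    have "\<bar>s *\<^sub>R v \<bullet> H (s *\<^sub>R u) - s *\<^sub>R u \<bullet> H (s *\<^sub>R v)\<bar> \<le> 4 * (e * (norm (s *\<^sub>R u) + norm (s *\<^sub>R v))\<^sup>2)"
      using second_difference[OF s(2)] second_difference[of "s *\<^sub>R v" "s *\<^sub>R u"] s(2)
      unfolding swap add.commute[of "norm (s *\<^sub>R v)"] by linarith
    also have "s *\<^sub>R v \<bullet> H (s *\<^sub>R u) - s *\<^sub>R u \<bullet> H (s *\<^sub>R v) = s\<^sup>2 * (H u \<bullet> v - H v \<bullet> u)"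
      by (simp add: linear_scale[OF linH] inner_commute power2_eq_square algebra_simps)
    also have "4 * (e * (norm (s *\<^sub>R u) + norm (s *\<^sub>R v))\<^sup>2) = s\<^sup>2 * (4 * (e * (norm u + norm v)\<^sup>2))"
      using s(1) by (simp add: power2_eq_square algebra_simps)
    finally show ?thesis using s(1) by (simp add: abs_mult)
  qed
  have "((\<lambda>e. 4 * (e * (norm u + norm v)\<^sup>2)) \<longlongrightarrow> 4 * (0 * (norm u + norm v)\<^sup>2)) (at_right 0)"
    by (intro tendsto_intros)
  then have "\<bar>H u \<bullet> v - H v \<bullet> u\<bar> \<le> 4 * (0 * (norm u + norm v)\<^sup>2)"
    by (rule tendsto_lowerbound) (use asymmetry_le in \<open>auto intro: eventually_mono[OF eventually_at_right_less]\<close>)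
  then show ?thesis by simp
qed

lemma has_integral_derivative_along_ray:
  fixes X :: "'a::real_normed_vector \<Rightarrow> 'b::banach"
  assumes X: "\<And>t. 0 \<le> t \<Longrightarrow> t \<le> 1 \<Longrightarrow> (X has_derivative X' (a + t *\<^sub>R v)) (at (a + t *\<^sub>R v))"
  shows "((\<lambda>t. t *\<^sub>R X' (a + t *\<^sub>R v) v + X (a + t *\<^sub>R v)) has_integral X (a + v)) {0..1}"
proof -
  have "((\<lambda>t. t *\<^sub>R X (a + t *\<^sub>R v)) has_vector_derivative t *\<^sub>R X' (a + t *\<^sub>R v) v + X (a + t *\<^sub>R v))
      (at t within {0..1})"
    if "t \<in> {0..1}" for t
  proof -
    have dX: "(X has_derivative X' (a + t *\<^sub>R v)) (at (a + t *\<^sub>R v))" using X that by simp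
    have "((\<lambda>t. a + t *\<^sub>R v) has_derivative (\<lambda>h. h *\<^sub>R v)) (at t within {0..1})"
      by (auto intro!: derivative_eq_intros)
    from has_derivative_compose[OF this dX]
    have "((\<lambda>t. X (a + t *\<^sub>R v)) has_vector_derivative X' (a + t *\<^sub>R v) v) (at t within {0..1})"
      unfolding has_vector_derivative_def linear_scale[OF has_derivative_linear[OF dX]] .
    then show ?thesis by (auto intro!: derivative_eq_intros)
  qed
  from fundamental_theorem_of_calculus[OF zero_le_one this] show ?thesis by simp
qed

definition ray_potential :: "('a::euclidean_space \<Rightarrow> 'a) \<Rightarrow> 'a \<Rightarrow> 'a \<Rightarrow> real" where
  "ray_potential X a x = integral (cbox 0 1) (\<lambda>t. X (a + t *\<^sub>R (x - a)) \<bullet> (x - a))"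

lemma GDERIV_ray_potential:
  fixes X :: "'a::euclidean_space \<Rightarrow> 'a" and X' :: "'a \<Rightarrow> 'a \<Rightarrow>\<^sub>L 'a"
  assumes P: "open P" "convex P" "a \<in> P" "x \<in> P"
    and X: "\<And>x. x \<in> P \<Longrightarrow> (X has_derivative X' x) (at x)" and cont: "continuous_on P X'"
    and sym: "\<And>x u v. x \<in> P \<Longrightarrow> X' x u \<bullet> v = X' x v \<bullet> u"
  shows "GDERIV (ray_potential X a) x :> X x"
proof -
  define p where "p x t = a + t *\<^sub>R (x - a)" for x t
  have p: "p x t \<in> P" if "x \<in> P" "0 \<le> t" "t \<le> 1" for x t
    using convexD_alt[OF P(2,3) that] by (simp add: p_def algebra_simps)
  have cont_p: "continuous_on T (p x)" "continuous_on U (\<lambda>y. p (fst y) (snd y))" for x T U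
    unfolding p_def by (intro continuous_intros)+
  have cont_X: "continuous_on P X"
    using X has_derivative_continuous continuous_at_imp_continuous_on by blast
  define D where "D x t = blinfun_inner_right (t *\<^sub>R X' (p x t) (x - a) + X (p x t))" for x t
  have deriv: "((\<lambda>x. X (p x t) \<bullet> (x - a)) has_derivative D x t) (at x within P)"
    if "x \<in> P" "t \<in> cbox 0 1" for x t
  proof -
    have y: "p x t \<in> P" using p that by simp
    have "((\<lambda>x. p x t) has_derivative (\<lambda>v. t *\<^sub>R v)) (at x within P)"
      unfolding p_def by (auto intro!: derivative_eq_intros)
    from has_derivative_compose[OF this X[OF y]]
    have dX: "((\<lambda>x. X (p x t)) has_derivative (\<lambda>v. X' (p x t) (t *\<^sub>R v))) (at x within P)" .
    have "((\<lambda>x. x - a) has_derivative (\<lambda>v. v)) (at x within P)"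
      by (auto intro!: derivative_eq_intros)
    from has_derivative_inner[OF dX this] show ?thesis
      by (rule has_derivative_eq_rhs) (simp add: D_def inner_add_left sym[OF y, of "t *\<^sub>R _"] fun_eq_iff)
  qed
  have integrable: "(\<lambda>t. X (p x t) \<bullet> (x - a)) integrable_on cbox 0 (1::real)" if "x \<in> P" for x
    using that
    by (intro integrable_continuous continuous_intros continuous_on_compose2[OF cont_X cont_p(1)]) (auto simp: p)
  have cont_D: "continuous_on (P \<times> cbox 0 1) (\<lambda>(x, t). D x t)"
    unfolding D_def split_beta
    by (intro continuous_intros continuous_on_compose2[OF cont_X cont_p(2)] continuous_on_compose2[OF cont cont_p(2)]
        bounded_linear.continuous_on[OF bounded_linear_blinfun_inner_right]) (auto simp: p)
  have "((\<lambda>t. t *\<^sub>R X' (p x t) (x - a) + X (p x t)) has_integral X x) {0..1}"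
    using has_integral_derivative_along_ray[of X "\<lambda>x. X' x" a "x - a"] X p[OF P(4)] by (simp add: p_def)
  from has_integral_linear[OF this bounded_linear_blinfun_inner_right]
  have "integral (cbox 0 1) (D x) = blinfun_inner_right (X x)"
    by (intro integral_unique) (simp add: D_def[abs_def] o_def)
  then show ?thesis
    using leibniz_rule[OF deriv integrable cont_D P(4,2)]
    unfolding gderiv_def at_within_open[OF P(4,1)] ray_potential_def[abs_def] p_def
    by (simp add: inner_commute[of _ "X x"])
qed

lemma ex_potential_of_symmetric_derivative:
  fixes X :: "'a::euclidean_space \<Rightarrow> 'a"
  assumes P: "open P" "convex P" and X: "\<And>x. x \<in> P \<Longrightarrow> (X has_derivative X' x) (at x)"
    and cont: "\<And>v. continuous_on P (\<lambda>x. X' x v)"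
    and sym: "\<And>x u v. x \<in> P \<Longrightarrow> X' x u \<bullet> v = X' x v \<bullet> u"
  obtains \<psi> where "\<And>x. x \<in> P \<Longrightarrow> GDERIV \<psi> x :> X x"
proof (cases "P = {}")
  case False
  then obtain a where a: "a \<in> P" by blast
  have Blinfun_apply: "blinfun_apply (Blinfun (X' x)) = X' x" if "x \<in> P" for x
    by (rule bounded_linear_Blinfun_apply[OF has_derivative_bounded_linear[OF X[OF that]]])
  have "continuous_on P (\<lambda>x. Blinfun (X' x))"
    by (rule continuous_on_blinfun_componentwise) (use cont Blinfun_apply in \<open>auto intro: continuous_on_eq\<close>)
  then have "GDERIV (ray_potential X a) x :> X x" if "x \<in> P" for x
    using GDERIV_ray_potential[OF P a that, of X "\<lambda>x. Blinfun (X' x)"] X sym by (simp add: Blinfun_apply)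
  then show thesis by (rule that)
qed simp

definition grad :: "('a::euclidean_space \<Rightarrow> real) \<Rightarrow> 'a \<Rightarrow> 'a" where
  "grad f x = (\<Sum>b\<in>Basis. dderiv f x b *\<^sub>R b)"

definition hess :: "('a::euclidean_space \<Rightarrow> real) \<Rightarrow> 'a \<Rightarrow> 'a \<Rightarrow> 'a" where
  "hess f x u = (\<Sum>b\<in>Basis. dderiv2 f x u b *\<^sub>R b)"

lemma smooth_on_imp_continuous_on: "smooth_on S f \<Longrightarrow> continuous_on S f"
  unfolding smooth_on_def by (metis Ck_on.simps(1))

lemma smooth_on_dderiv: "smooth_on S f \<Longrightarrow> smooth_on S (\<lambda>x. dderiv f x v)"
  unfolding smooth_on_def dderiv_def by (metis Ck_on.simps(2))

lemma smooth_on_has_derivative: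
  assumes "open S" "smooth_on S f" "x \<in> S"
  shows "(f has_derivative dderiv f x) (at x)"
proof -
  have "f differentiable_on S" using assms(2) unfolding smooth_on_def by (metis Ck_on.simps(2))
  then have "f differentiable (at x)"
    using assms(1,3) by (simp add: differentiable_on_eq_differentiable_at)
  then show ?thesis
    unfolding dderiv_def[abs_def] by (simp add: frechet_derivative_works)
qed

lemma smooth_on_GDERIV_grad:
  assumes "open S" "smooth_on S f" "x \<in> S"
  shows "GDERIV f x :> grad f x"
proof -
  note deriv = smooth_on_has_derivative[OF assms]
  note lin = has_derivative_linear[OF deriv]
  have "dderiv f x v = v \<bullet> grad f x" for v
    using linear_sum[OF lin, of "\<lambda>b. (v \<bullet> b) *\<^sub>R b" Basis]
    by (simp add: euclidean_representation linear_scale[OF lin] grad_def inner_sum_right mult.commute)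
  with deriv show ?thesis unfolding gderiv_def by (metis ext)
qed

lemma smooth_on_has_derivative_grad:
  assumes "open S" "smooth_on S f" "x \<in> S"
  shows "(grad f has_derivative hess f x) (at x)"
  unfolding grad_def[abs_def] hess_def[abs_def] dderiv2_def
  by (intro has_derivative_sum has_derivative_scaleR_left
      smooth_on_has_derivative[OF assms(1) smooth_on_dderiv assms(3)] assms(2))

lemma dderiv2_eq_hess_inner:
  assumes "open S" "smooth_on S f" "x \<in> S"
  shows "dderiv2 f x u v = hess f x u \<bullet> v"
proof -
  have "((\<lambda>y. grad f y \<bullet> v) has_derivative (\<lambda>u. hess f x u \<bullet> v)) (at x)"
    by (rule has_derivative_inner_left[OF smooth_on_has_derivative_grad[OF assms]])
  then have "((\<lambda>y. dderiv f y v) has_derivative (\<lambda>u. hess f x u \<bullet> v)) (at x)"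
  proof (rule has_derivative_transform_within_open[OF _ assms(1,3)])
    show "grad f y \<bullet> v = dderiv f y v" if "y \<in> S" for y
      using smooth_on_GDERIV_grad[OF assms(1,2) that] smooth_on_has_derivative[OF assms(1,2) that]
      unfolding gderiv_def by (metis has_derivative_unique inner_commute)
  qed
  from has_derivative_unique[OF this smooth_on_has_derivative[OF assms(1) smooth_on_dderiv[OF assms(2)] assms(3)]]
  show ?thesis by (simp add: dderiv2_def fun_eq_iff)
qed

lemma continuous_on_hess: "smooth_on S f \<Longrightarrow> continuous_on S (\<lambda>x. hess f x u)"
  unfolding hess_def dderiv2_def
  by (intro continuous_intros smooth_on_imp_continuous_on smooth_on_dderiv)

lemma linear_hess:
  assumes "open S" "smooth_on S f" "x \<in> S"
  shows "linear (hess f x)"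
  by (rule has_derivative_linear[OF smooth_on_has_derivative_grad[OF assms]])

lemma hess_symmetric:
  assumes "open S" "smooth_on S f" "x \<in> S"
  shows "hess f x u \<bullet> v = hess f x v \<bullet> u"
  by (rule symmetric_second_derivative[OF assms(1,3) smooth_on_GDERIV_grad[OF assms(1,2)]
        smooth_on_has_derivative_grad[OF assms]])

section \<open>The Levi form\<close>

definition levi_form :: "(complex^'n \<Rightarrow> real) \<Rightarrow> complex^'n \<Rightarrow> complex^'n \<Rightarrow> complex^'n \<Rightarrow> real" where
  "levi_form f x u v = (hess f x u \<bullet> v + hess f x (\<i> *s u) \<bullet> (\<i> *s v)) / 4"

lemma vector_smult_ii [simp]: "\<i> *s (\<i> *s v) = - (v::complex^'n)"
  by (simp add: vec_eq_iff flip: mult.assoc)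

lemma inner_vector_smult_ii_left: "(\<i> *s u) \<bullet> v = - (u \<bullet> (\<i> *s (v::complex^'n)))"
  by (simp add: inner_vec_def inner_complex_def sum_negf[symmetric] algebra_simps)

lemma bilinear_levi_form:
  fixes x :: "complex^'n"
  assumes "open S" "smooth_on S f" "x \<in> S"
  shows "bilinear (levi_form f x)"
  using linear_hess[OF assms]
  unfolding bilinear_def levi_form_def
  by (auto intro!: linearI
      simp: linear_add linear_scale linear_scale[OF linear_vector_smult] inner_add_left inner_add_right
        add_divide_distrib distrib_left)

lemma levi_form_commute:
  assumes "open S" "smooth_on S f" "x \<in> S"
  shows "levi_form f x u v = levi_form f x v u"
  unfolding levi_form_def hess_symmetric[OF assms, of u] hess_symmetric[OF assms, of "\<i> *s u"] ..

lemma levi_form_smult: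
  assumes "open S" "smooth_on S f" "x \<in> S"
  shows "levi_form f x (c *s u) (c *s u) = (cmod c)\<^sup>2 * levi_form f x u u"
proof -
  note bil = bilinear_levi_form[OF assms]
  have rotate: "levi_form f x (\<i> *s u) (\<i> *s u) = levi_form f x u u"
      "levi_form f x (\<i> *s u) u = - levi_form f x u (\<i> *s u)"
    by (simp_all add: levi_form_def linear_neg[OF linear_hess[OF assms]] field_simps)
  show ?thesis
    unfolding vector_smult_eq_scaleR[of c u] bilinear_ladd[OF bil] bilinear_radd[OF bil]
      bilinear_lmul[OF bil] bilinear_rmul[OF bil] rotate cmod_power2
    by (simp add: algebra_simps power2_eq_square)
qed

lemma levi_form_eq_0_iff:
  assumes "open S" "smooth_on S f" "x \<in> S"
  shows "(\<forall>u v. levi_form f x u v = 0) \<longleftrightarrow> (\<forall>u. levi_form f x u u = 0)"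
proof (intro iffI allI)
  fix u v assume diag: "\<forall>u. levi_form f x u u = 0"
  note bil = bilinear_levi_form[OF assms]
  have "levi_form f x (u + v) (u + v)
      = levi_form f x u u + levi_form f x u v + levi_form f x v u + levi_form f x v v"
    by (simp add: bilinear_ladd[OF bil] bilinear_radd[OF bil])
  with diag levi_form_commute[OF assms, of v u] show "levi_form f x u v = 0" by simp
qed simp

lemma ddbar_eq_0_iff:
  fixes x :: "complex^'n"
  assumes "open S" "smooth_on S f" "x \<in> S"
  shows "(\<forall>j k. ddbar f x j k = 0) \<longleftrightarrow> (\<forall>u v. levi_form f x u v = 0)"
proof -
  note bil = bilinear_levi_form[OF assms]
  have i_axis: "\<i> *s axis j 1 = axis j \<i>" "\<i> *s axis j \<i> = - axis j (1::complex)" for j :: 'n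
    by (auto simp: vec_eq_iff axis_def)
  have ddbar: "ddbar f x j k = 0 \<longleftrightarrow>
      levi_form f x (axis j 1) (axis k 1) = 0 \<and> levi_form f x (axis j 1) (axis k \<i>) = 0" for j k
    by (simp add: ddbar_def dderiv2_eq_hess_inner[OF assms] levi_form_def i_axis complex_eq_iff)
  show ?thesis
  proof
    assume zero: "\<forall>j k. ddbar f x j k = 0"
    have "levi_form f x = (\<lambda>u v. 0)"
    proof (rule bilinear_eq_stdbasis[OF bil])
      show "bilinear (\<lambda>u v. 0 :: real)" by (simp add: bilinear_def module_hom_zero)
      fix a b :: "complex^'n" assume "a \<in> Basis" "b \<in> Basis"
      then obtain j k where "a \<in> {axis j 1, axis j \<i>}" "b \<in> {axis k 1, axis k \<i>}"
        by (auto simp: Basis_vec_def Basis_complex_def)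
      moreover have "levi_form f x (axis j 1) (axis k 1) = 0" "levi_form f x (axis j 1) (axis k \<i>) = 0"
        using zero ddbar by auto
      ultimately show "levi_form f x a b = 0"
        by (auto simp: levi_form_def i_axis linear_neg[OF linear_hess[OF assms]])
    qed
    then show "\<forall>u v. levi_form f x u v = 0" by (simp add: fun_eq_iff)
  qed (simp add: ddbar)
qed

corollary pluriharmonic_on_iff_levi_form:
  assumes "open S" "smooth_on S f"
  shows "pluriharmonic_on S f \<longleftrightarrow> (\<forall>x\<in>S. \<forall>u. levi_form f x u u = 0)"
  unfolding pluriharmonic_on_def using ddbar_eq_0_iff[OF assms] levi_form_eq_0_iff[OF assms] by blast

lemma ex_holo_on_Re_eq:
  fixes f :: "complex^'n \<Rightarrow> real"
  assumes P: "open P" "convex P" and G: "\<And>x. x \<in> P \<Longrightarrow> GDERIV f x :> G x"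
    and H: "\<And>x. x \<in> P \<Longrightarrow> (G has_derivative H x) (at x)" "\<And>v. continuous_on P (\<lambda>x. H x v)"
    and levi: "\<And>x u v. x \<in> P \<Longrightarrow> H x (\<i> *s u) \<bullet> (\<i> *s v) = - (H x u \<bullet> v)"
  obtains h where "holo_on P h" "\<And>x. x \<in> P \<Longrightarrow> Re (h x) = f x"
proof -
  have symH: "H x u \<bullet> v = H x v \<bullet> u" if "x \<in> P" for x u v
    by (rule symmetric_second_derivative[OF P(1) that G H(1)[OF that]])
  have deriv: "((\<lambda>x. \<i> *s G x) has_derivative (\<lambda>u. \<i> *s H x u)) (at x)" if "x \<in> P" for x
    using has_derivative_vector_smult[OF has_derivative_const H(1)[OF that], of \<i>] by simp
  have cont: "continuous_on P (\<lambda>x. \<i> *s H x v)" for v by (intro continuous_intros H)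
  have sym: "(\<i> *s H x u) \<bullet> v = (\<i> *s H x v) \<bullet> u" if "x \<in> P" for x u v
  proof -
    have "H x u \<bullet> (\<i> *s v) = H x (\<i> *s u) \<bullet> v"
      using levi[OF that, of u "\<i> *s v"] by simp
    also have "\<dots> = H x v \<bullet> (\<i> *s u)" by (rule symH[OF that])
    finally show ?thesis by (simp add: inner_vector_smult_ii_left)
  qed
  obtain \<psi> where \<psi>: "\<And>x. x \<in> P \<Longrightarrow> GDERIV \<psi> x :> \<i> *s G x"
    using ex_potential_of_symmetric_derivative[OF P deriv cont sym] by metis
  define h where "h x = complex_of_real (f x) + \<i> * complex_of_real (\<psi> x)" for x
  have "holo_on P h"
  proof (rule holo_onI)
    fix x assume x: "x \<in> P"
    let ?L = "\<lambda>v. complex_of_real (v \<bullet> G x) + \<i> * complex_of_real (v \<bullet> (\<i> *s G x))"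
    have "(h has_derivative ?L) (at x)"
      using G[OF x] \<psi>[OF x] unfolding h_def[abs_def] gderiv_def
      by (intro has_derivative_add has_derivative_mult_right has_derivative_of_real)
    then show der: "(h has_derivative ?L) (at x within P)" by (rule has_derivative_at_withinI)
    show "?L (c *s v) = c * ?L v" for c v
      by (rule complex_linearI[OF has_derivative_linear[OF der]])
         (simp add: inner_vector_smult_ii_left complex_eq_iff)
  qed
  then show thesis by (rule that) (simp add: h_def)
qed

lemma pluriharmonic_on_imp_Re_holo:
  assumes S: "open S" "smooth_on S \<phi>" "pluriharmonic_on S \<phi>" and P: "open P" "convex P" "P \<subseteq> S"
  obtains h where "holo_on P h" "\<And>x. x \<in> P \<Longrightarrow> Re (h x) = \<phi> x"
proof (rule ex_holo_on_Re_eq[OF P(1,2)])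
  show "GDERIV \<phi> x :> grad \<phi> x" "(grad \<phi> has_derivative hess \<phi> x) (at x)" if "x \<in> P" for x
    using that P(3) smooth_on_GDERIV_grad[OF S(1,2)] smooth_on_has_derivative_grad[OF S(1,2)] by blast+
  show "continuous_on P (\<lambda>x. hess \<phi> x v)" for v
    using continuous_on_hess[OF S(2)] P(3) continuous_on_subset by blast
  show "hess \<phi> x (\<i> *s u) \<bullet> (\<i> *s v) = - (hess \<phi> x u \<bullet> v)" if "x \<in> P" for x u v
  proof -
    have "levi_form \<phi> x u v = 0"
      using S(3) that P(3) ddbar_eq_0_iff[OF S(1,2)] by (auto simp: pluriharmonic_on_def)
    then show ?thesis by (simp add: levi_form_def)
  qed
qed (rule that)

text \<open>Taking \<open>Re q z = z \<bullet> (grad f x + K z /\<^sub>R 2)\<close>, where \<open>K\<close> is the part of the Hessian that anticommutes with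
  multiplication by \<open>\<i>\<close>.\<close>
lemma ex_holo_on_Re_plus_levi_form:
  fixes f :: "complex^'n \<Rightarrow> real"
  assumes S: "open S" "smooth_on S f" and x: "x \<in> S"
  obtains q where "holo_on UNIV q" "q 0 = 0"
    "\<And>z. Re (q z) + levi_form f x z z = z \<bullet> (grad f x + hess f x z /\<^sub>R 2)"
proof -
  define K where "K u = (hess f x u + \<i> *s hess f x (\<i> *s u)) /\<^sub>R 2" for u
  define p where "p z = z \<bullet> (grad f x + K z /\<^sub>R 2)" for z
  note lin = linear_hess[OF S x]
  have linK: "linear K"
    by (rule linearI)
       (simp_all add: K_def linear_add[OF lin] linear_scale[OF lin] linear_scale[OF linear_vector_smult]
         vector_add_ldistrib algebra_simps)
  have dK: "(K has_derivative K) (at z)" for z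
    using linK by (simp add: linear_conv_bounded_linear bounded_linear_imp_has_derivative)
  have K_sym: "K u \<bullet> v = K v \<bullet> u" for u v
    by (simp add: K_def inner_add_left inner_vector_smult_ii_left hess_symmetric[OF S x, of u v]
        hess_symmetric[OF S x, of "\<i> *s u" "\<i> *s v"])
  have K_ii: "K (\<i> *s u) \<bullet> (\<i> *s v) = - (K u \<bullet> v)" for u v
    by (simp add: K_def inner_add_left inner_diff_left inner_vector_smult_ii_left linear_neg[OF lin] field_simps)
  have "GDERIV p z :> grad f x + K z" for z
  proof -
    have "(p has_derivative (\<lambda>v. z \<bullet> (K v /\<^sub>R 2) + v \<bullet> (grad f x + K z /\<^sub>R 2))) (at z)"
      unfolding p_def[abs_def]
      by (rule has_derivative_inner[OF has_derivative_ident]) (auto intro!: derivative_eq_intros dK)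
    moreover have "z \<bullet> (K v /\<^sub>R 2) + v \<bullet> (grad f x + K z /\<^sub>R 2) = v \<bullet> (grad f x + K z)" for v
      by (simp add: inner_add_right inner_commute[of z] K_sym[of v z] inner_commute[of v "K z"])
    ultimately show ?thesis unfolding gderiv_def by simp
  qed
  moreover have "((\<lambda>z. grad f x + K z) has_derivative K) (at z)" for z
    by (auto intro!: derivative_eq_intros dK)
  ultimately obtain h where h: "holo_on UNIV h" "\<And>z. Re (h z) = p z"
    using ex_holo_on_Re_eq[of UNIV p "\<lambda>z. grad f x + K z" "\<lambda>_. K"] K_ii
    by (metis UNIV_I continuous_on_const convex_UNIV open_UNIV)
  show thesis
  proof (rule that[of "\<lambda>z. h z + (- h 0)"])
    show "holo_on UNIV (\<lambda>z. h z + (- h 0))" by (intro holo_on_add holo_on_const h)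
    show "Re (h z + (- h 0)) + levi_form f x z z = z \<bullet> (grad f x + hess f x z /\<^sub>R 2)" for z
      by (simp add: h(2) p_def K_def levi_form_def inner_add_right inner_commute[of z]
          inner_vector_smult_ii_left field_simps)
  qed simp
qed

lemma levi_expansion:
  fixes f :: "complex^'n \<Rightarrow> real"
  assumes S: "open S" "smooth_on S f" and x: "x \<in> S" and e: "0 < e"
  obtains q d where "holo_on UNIV q" "q 0 = 0" "0 < d" "ball x d \<subseteq> S"
    "\<And>z. norm z < d \<Longrightarrow> \<bar>f (x + z) - f x - Re (q z) - levi_form f x z z\<bar> \<le> e * (norm z)\<^sup>2"
proof -
  obtain q where q: "holo_on UNIV q" "q 0 = 0"
    and Re_q: "\<And>z. Re (q z) + levi_form f x z z = z \<bullet> (grad f x + hess f x z /\<^sub>R 2)"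
    using ex_holo_on_Re_plus_levi_form[OF S x] by metis
  obtain d where d: "0 < d" "ball x d \<subseteq> S" "\<And>z w. norm z + norm w < d \<Longrightarrow>
      \<bar>f (x + z + w) - f (x + z) - w \<bullet> (grad f x + hess f x z + hess f x w /\<^sub>R 2)\<bar>
        \<le> e * (norm z + norm w) * norm w"
    using increment_second_order[OF S(1) x smooth_on_GDERIV_grad[OF S] smooth_on_has_derivative_grad[OF S x] e]
    by metis
  have "\<bar>f (x + z) - f x - Re (q z) - levi_form f x z z\<bar> \<le> e * (norm z)\<^sup>2" if "norm z < d" for z
    using d(3)[of 0 z] that Re_q[of z]
    by (simp add: linear_0[OF linear_hess[OF S x]] power2_eq_square mult.assoc diff_diff_eq)
  with q d(1,2) show thesis by (rule that)
qed

section \<open>Cylinders\<close>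

definition drop_first :: "complex^'n \<Rightarrow> complex^'n" where
  "drop_first z = (\<chi> i. if i = first_idx then 0 else z $ i)"

lemma norm_drop_first: "norm (drop_first z) = sqrt (\<Sum>i\<in>UNIV - {first_idx}. (cmod (z $ i))\<^sup>2)"
proof -
  have "(\<Sum>i\<in>UNIV. (cmod (drop_first z $ i))\<^sup>2) = (\<Sum>i\<in>UNIV - {first_idx}. (cmod (z $ i))\<^sup>2)"
    by (rule sum.mono_neutral_cong_right) (auto simp: drop_first_def)
  then show ?thesis by (simp add: norm_vec_def L2_set_def)
qed

lemma linear_drop_first: "linear drop_first"
  by (rule linearI) (simp_all add: drop_first_def vec_eq_iff)

lemma first_drop_decomposition: "z $ first_idx *s first_axis + drop_first z = z"
  by (simp add: drop_first_def vec_eq_iff axis_def)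

lemma cyl0_eq: "cyl0 r s = {z. cmod (z $ first_idx) < r \<and> norm (drop_first z) < s}"
  by (simp add: cyl0_def norm_drop_first)

lemma cyl0_eq_vimage: "cyl0 r s = (\<lambda>z. z $ first_idx) -` ball 0 r \<inter> drop_first -` ball 0 s"
  by (auto simp: cyl0_eq)

lemma open_cyl0: "open (cyl0 r s)"
  unfolding cyl0_eq_vimage
  by (intro open_Int open_vimage open_ball continuous_intros linear_continuous_on)
     (simp add: linear_drop_first flip: linear_conv_bounded_linear)

lemma borel_cyl0 [measurable]: "cyl0 r s \<in> sets borel"
  using open_cyl0 by (rule borel_open)

lemma convex_cyl0: "convex (cyl0 r s)"
  unfolding cyl0_eq_vimage
  by (intro convex_Int convex_linear_vimage convex_ball linear_drop_first
      bounded_linear.linear[OF bounded_linear_vec_nth])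

lemma zero_in_cyl0: "0 < r \<Longrightarrow> 0 < s \<Longrightarrow> 0 \<in> cyl0 r s"
  by (simp add: cyl0_eq linear_0[OF linear_drop_first])

lemma balanced_cyl0: "balanced (cyl0 r s)"
  unfolding balanced_def
proof (intro allI impI)
  fix c and z :: "complex^'n" assume c: "cmod c \<le> 1" and z: "z \<in> cyl0 r s"
  have "drop_first (c *s z) = c *s drop_first z" by (simp add: drop_first_def vec_eq_iff)
  then show "c *s z \<in> cyl0 r s"
    using z mult_left_le_one_le[OF norm_ge_zero norm_ge_zero c, of "z $ first_idx"]
      mult_left_le_one_le[OF norm_ge_zero norm_ge_zero c, of "drop_first z"]
    by (simp add: cyl0_eq norm_mult norm_vector_smult)
qed

lemma norm_less_of_mem_cyl0:
  assumes "z \<in> cyl0 r s"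
  shows "norm z < r + s"
proof -
  have "norm z \<le> cmod (z $ first_idx) + norm (drop_first z)"
    using norm_triangle_ineq[of "z $ first_idx *s first_axis" "drop_first z"]
    by (simp add: first_drop_decomposition norm_vector_smult norm_axis_1)
  then show ?thesis using assms by (simp add: cyl0_eq)
qed

lemma bounded_cyl0: "bounded (cyl0 r s)"
  by (rule boundedI) (use norm_less_of_mem_cyl0 less_imp_le in blast)

lemma lmeasurable_cyl0: "cyl0 r s \<in> lmeasurable"
  by (intro lmeasurable_open bounded_cyl0 open_cyl0)

lemma emeasure_cyl0:
  "emeasure lborel (cyl0 r s :: (complex^'n) set) = ennreal (measure lborel (cyl0 r s :: (complex^'n) set))"
  by (intro emeasure_eq_ennreal_measure less_imp_neq bounded_cyl0
      emeasure_bounded_finite[unfolded infinity_ennreal_def])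

lemma measure_cyl0_pos:
  assumes "0 < r" "0 < s"
  shows "0 < measure lborel (cyl0 r s :: (complex^'n) set)"
proof -
  have "\<not> negligible (cyl0 r s :: (complex^'n) set)"
    using open_not_negligible[OF open_cyl0] zero_in_cyl0[OF assms] by blast
  then show ?thesis
    by (simp add: negligible_iff_measure lmeasurable_cyl0 zero_less_measure_iff)
qed

lemma measure_half_cyl0_le:
  assumes "0 < r"
  shows "2 * measure lborel (cyl0 (r / 2) s :: (complex^'n) set)
    \<le> measure lborel (cyl0 r s :: (complex^'n) set)"
proof -
  let ?C = "cyl0 (r / 2) s :: (complex^'n) set"
  define v :: "complex^'n" where "v = axis first_idx (of_real (r / 2))"
  have first_v: "v $ first_idx = of_real (r / 2)" by (simp add: v_def)
  have drop_v: "drop_first (v + z) = drop_first z" "drop_first (z - v) = drop_first z" for z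
    by (simp_all add: v_def drop_first_def vec_eq_iff axis_def)
  have "v + z \<in> cyl0 r s \<and> - v + z \<in> cyl0 r s" if "z \<in> ?C" for z
    using that assms norm_triangle_ineq[of "v $ first_idx" "z $ first_idx"]
      norm_triangle_ineq4[of "z $ first_idx" "v $ first_idx"] by (simp add: cyl0_eq drop_v first_v)
  then have "(\<lambda>z. v + z) ` ?C \<subseteq> cyl0 r s" "(\<lambda>z. - v + z) ` ?C \<subseteq> cyl0 r s" by blast+
  moreover have "(\<lambda>z. v + z) ` ?C \<inter> (\<lambda>z. - v + z) ` ?C = {}"
  proof -
    have Re: "\<bar>Re (z $ first_idx)\<bar> < r / 2" if "z \<in> ?C" for z
      using that abs_Re_le_cmod[of "z $ first_idx"] by (simp add: cyl0_eq)
    have "v + y \<noteq> - v + z" if "y \<in> ?C" "z \<in> ?C" for y z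
    proof
      assume "v + y = - v + z"
      then have "v $ first_idx + y $ first_idx = - (v $ first_idx) + z $ first_idx"
        by (metis vector_add_component vector_uminus_component)
      then have "r / 2 + Re (y $ first_idx) = - (r / 2) + Re (z $ first_idx)"
        by (simp add: first_v complex_eq_iff)
      then show False using Re[OF that(1)] Re[OF that(2)] by linarith
    qed
    then show ?thesis by blast
  qed
  ultimately have "2 * measure lebesgue ?C \<le> measure lebesgue (cyl0 r s :: (complex^'n) set)"
    by (rule measure_disjoint_translates_le[OF lmeasurable_cyl0 lmeasurable_cyl0])
  then show ?thesis by simp
qed

lemma second_moment_cyl0_ge:
  assumes "0 < r"
  shows "r\<^sup>2 / 8 * measure lborel (cyl0 r s :: (complex^'n) set)
    \<le> (LINT z:cyl0 r s|lborel. (cmod ((z::complex^'n) $ first_idx))\<^sup>2)"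
proof -
  let ?P = "cyl0 r s :: (complex^'n) set" and ?Q = "cyl0 (r / 2) s :: (complex^'n) set"
  have sub: "?Q \<subseteq> ?P" using assms by (auto simp: cyl0_eq)
  have half: "2 * measure lborel ?Q \<le> measure lborel ?P" by (rule measure_half_cyl0_le[OF assms])
  have fin: "emeasure lborel ?P \<noteq> \<infinity>" "emeasure lborel (?P - ?Q) \<noteq> \<infinity>"
    using bounded_cyl0 bounded_diff emeasure_bounded_finite by (metis less_irrefl)+
  have integrable: "set_integrable lborel ?P (\<lambda>z. (cmod (z $ first_idx))\<^sup>2)"
    by (intro set_integrable_continuous_bounded bounded_cyl0 continuous_intros) simp
  have "r\<^sup>2 / 8 * measure lborel ?P \<le> r\<^sup>2 / 4 * measure lborel (?P - ?Q)"
    using fin(1) mult_left_mono[OF half, of "r\<^sup>2 / 8"]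
    by (subst measure_Diff[OF _ _ _ sub]) (simp_all add: algebra_simps)
  also have "\<dots> = (LINT z:?P - ?Q|lborel. r\<^sup>2 / 4)"
    using fin(2) by (subst set_integral_const) auto
  also have "\<dots> \<le> (LINT z:?P - ?Q|lborel. (cmod (z $ first_idx))\<^sup>2)"
  proof (rule set_integral_mono)
    show "set_integrable lborel (?P - ?Q) (\<lambda>z. (cmod (z $ first_idx))\<^sup>2)"
      by (rule set_integrable_subset[OF integrable]) auto
    show "set_integrable lborel (?P - ?Q) (\<lambda>z. r\<^sup>2 / 4)"
      by (intro set_integrable_continuous_bounded bounded_diff bounded_cyl0 continuous_intros) simp
    show "r\<^sup>2 / 4 \<le> (cmod (z $ first_idx))\<^sup>2" if "z \<in> ?P - ?Q" for z
      using that power_mono[of "r / 2" "cmod (z $ first_idx)" 2] assms by (auto simp: cyl0_eq power_divide)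
  qed
  also have "\<dots> \<le> (LINT z:?P|lborel. (cmod (z $ first_idx))\<^sup>2)"
    unfolding set_lebesgue_integral_def
  proof (rule integral_mono)
    show "integrable lborel (\<lambda>z. indicator (?P - ?Q) z *\<^sub>R (cmod (z $ first_idx))\<^sup>2)"
      using set_integrable_subset[OF integrable, of "?P - ?Q"] by (simp add: set_integrable_def)
  qed (use integrable in \<open>auto simp: set_integrable_def indicator_def\<close>)
  finally show ?thesis .
qed

lemma exp_minus_le_one_minus_half:
  fixes t :: real
  assumes "0 \<le> t" "t \<le> 1"
  shows "exp (- t) \<le> 1 - t / 2"
proof -
  have "1 \<le> (1 - t / 2) * (1 + t)"
    using assms mult_left_le[of t t] by (simp add: field_simps)
  also have "\<dots> \<le> (1 - t / 2) * exp t"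
    using assms exp_ge_add_one_self[of t] by (intro mult_left_mono) (auto simp: add.commute)
  finally show ?thesis by (simp add: exp_minus field_simps)
qed

definition axis_gaussian :: "real \<Rightarrow> (complex^'n) set \<Rightarrow> real" where
  "axis_gaussian \<kappa> P = (LINT z:P|lborel. exp (- (\<kappa> * (cmod (z $ first_idx))\<^sup>2)))"

lemma axis_gaussian_cyl0_le:
  fixes \<kappa> r s :: real
  assumes r: "0 < r" and \<kappa>: "0 < \<kappa>" "\<kappa> * r\<^sup>2 \<le> 1"
  defines "P \<equiv> cyl0 r s :: (complex^'n) set"
  shows "axis_gaussian \<kappa> P \<le> (1 - \<kappa> * r\<^sup>2 / 16) * measure lborel P"
proof -
  have finite: "emeasure lborel P \<noteq> \<infinity>" and borel: "P \<in> sets borel"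
    by (simp_all add: P_def emeasure_cyl0 borel_cyl0)
  have integrable: "set_integrable lborel P f" if "continuous_on UNIV f" for f :: "complex^'n \<Rightarrow> real"
    unfolding P_def by (rule set_integrable_continuous_bounded[OF that bounded_cyl0 borel_cyl0])
  have "axis_gaussian \<kappa> P \<le> (LINT z:P|lborel. 1 - \<kappa> / 2 * (cmod (z $ first_idx))\<^sup>2)"
    unfolding axis_gaussian_def
  proof (rule set_integral_mono)
    fix z assume "z \<in> P"
    then have "(cmod (z $ first_idx))\<^sup>2 \<le> r\<^sup>2" by (intro power_mono) (auto simp: P_def cyl0_eq)
    then have "\<kappa> * (cmod (z $ first_idx))\<^sup>2 \<le> \<kappa> * r\<^sup>2" using \<kappa>(1) by (intro mult_left_mono) auto
    then show "exp (- (\<kappa> * (cmod (z $ first_idx))\<^sup>2)) \<le> 1 - \<kappa> / 2 * (cmod (z $ first_idx))\<^sup>2"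
      using exp_minus_le_one_minus_half[OF _ order_trans[OF _ \<kappa>(2)]] \<kappa>(1) by simp
  qed (intro integrable continuous_intros)+
  also have "\<dots> = measure lborel P - \<kappa> / 2 * (LINT z:P|lborel. (cmod (z $ first_idx))\<^sup>2)"
    using finite
    by (subst set_integral_diff) (auto intro!: integrable continuous_intros simp: set_integral_const borel)
  also have "\<dots> \<le> measure lborel P - \<kappa> / 2 * (r\<^sup>2 / 8 * measure lborel P)"
    unfolding P_def using \<kappa>(1) second_moment_cyl0_ge[OF r] by (intro diff_left_mono mult_left_mono) auto
  finally show ?thesis by (simp add: algebra_simps)
qed

lemma axis_gaussian_cyl0_ge:
  fixes \<kappa> r s :: real
  assumes r: "0 < r" and \<kappa>: "\<kappa> < 0"
  defines "P \<equiv> cyl0 r s :: (complex^'n) set"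
  shows "(1 - \<kappa> * r\<^sup>2 / 8) * measure lborel P \<le> axis_gaussian \<kappa> P"
proof -
  have finite: "emeasure lborel P \<noteq> \<infinity>" and borel: "P \<in> sets borel"
    by (simp_all add: P_def emeasure_cyl0 borel_cyl0)
  have integrable: "set_integrable lborel P f" if "continuous_on UNIV f" for f :: "complex^'n \<Rightarrow> real"
    unfolding P_def by (rule set_integrable_continuous_bounded[OF that bounded_cyl0 borel_cyl0])
  have "(1 - \<kappa> * r\<^sup>2 / 8) * measure lborel P = measure lborel P + (- \<kappa>) * (r\<^sup>2 / 8 * measure lborel P)"
    by (simp add: algebra_simps)
  also have "\<dots> \<le> measure lborel P + (- \<kappa>) * (LINT z:P|lborel. (cmod (z $ first_idx))\<^sup>2)"
    unfolding P_def using \<kappa> second_moment_cyl0_ge[OF r] by (intro add_left_mono mult_left_mono) auto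
  also have "\<dots> = (LINT z:P|lborel. 1 + (- \<kappa>) * (cmod (z $ first_idx))\<^sup>2)"
    using finite unfolding set_integral_mult_right[symmetric]
    by (subst set_integral_add) (auto intro!: integrable continuous_intros simp: set_integral_const borel)
  also have "\<dots> \<le> axis_gaussian \<kappa> P"
    unfolding axis_gaussian_def mult_minus_left
    by (intro set_integral_mono integrable continuous_intros exp_ge_add_one_self)
  finally show ?thesis .
qed

lemma axis_gaussian_cyl0_imp_eq_0:
  fixes \<kappa> r s :: real
  defines "P \<equiv> cyl0 r s :: (complex^'n) set" and "x \<equiv> \<bar>\<kappa>\<bar> * r\<^sup>2 / 32"
  assumes r: "0 < r" and s: "0 < s" and small: "\<bar>\<kappa>\<bar> * r\<^sup>2 \<le> 1"
    and gaussian_le: "exp (- x) * axis_gaussian \<kappa> P \<le> measure lborel P"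
    and gaussian_ge: "measure lborel P \<le> exp x * axis_gaussian \<kappa> P"
  shows "\<kappa> = 0"
proof (rule ccontr)
  assume "\<kappa> \<noteq> 0"
  then have x: "0 < x" "x \<le> 1 / 32" using r small by (auto simp: x_def)
  define V where "V = measure lborel P"
  have V: "0 < V" unfolding V_def P_def by (rule measure_cyl0_pos[OF r s])
  consider (pos) "0 < \<kappa>" | (neg) "\<kappa> < 0" using \<open>\<kappa> \<noteq> 0\<close> by linarith
  then show False
  proof cases
    case pos
    then have "axis_gaussian \<kappa> P \<le> (1 - 2 * x) * V"
      using axis_gaussian_cyl0_le[OF r, of \<kappa> s] small by (simp add: P_def V_def x_def)
    also have "\<dots> \<le> exp (- 2 * x) * V"
      using V exp_ge_add_one_self[of "- 2 * x"] by (intro mult_right_mono) auto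
    finally have "exp x * axis_gaussian \<kappa> P \<le> exp x * (exp (- 2 * x) * V)" by (intro mult_left_mono) auto
    also have "\<dots> = exp (- x) * V" by (simp flip: exp_add mult.assoc)
    also have "\<dots> < 1 * V" using x V by (intro mult_strict_right_mono) auto
    finally show False using gaussian_ge by (simp add: V_def)
  next
    case neg
    have "1 * V < (1 - x) * (1 + 4 * x) * V"
    proof (intro mult_strict_right_mono V)
      have "x * (4 * x) < x * 3" using x by (intro mult_strict_left_mono) auto
      then show "1 < (1 - x) * (1 + 4 * x)" by (simp add: algebra_simps)
    qed
    also have "\<dots> \<le> exp (- x) * (1 + 4 * x) * V"
      using x V exp_ge_add_one_self[of "- x"] by (intro mult_right_mono) auto
    also have "\<dots> \<le> exp (- x) * axis_gaussian \<kappa> P"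
      using axis_gaussian_cyl0_ge[OF r, of \<kappa> s] neg by (simp add: P_def V_def x_def)
    finally show False using gaussian_le by (simp add: V_def)
  qed
qed

lemma set_nn_integral_axis_gaussian_cyl0:
  fixes \<kappa> c r s :: real
  defines "P \<equiv> cyl0 r s :: (complex^'n) set"
  shows "(\<integral>\<^sup>+ z\<in>P. ennreal (exp (- (\<kappa> * (cmod (z $ first_idx))\<^sup>2 + c))) \<partial>lborel)
    = ennreal (exp (- c) * axis_gaussian \<kappa> P)"
proof -
  have "(\<integral>\<^sup>+ z\<in>P. ennreal (exp (- (\<kappa> * (cmod (z $ first_idx))\<^sup>2 + c))) \<partial>lborel)
      = ennreal (LINT z:P|lborel. exp (- (\<kappa> * (cmod (z $ first_idx))\<^sup>2 + c)))"
    unfolding P_def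
    by (intro set_nn_integral_eq_set_integral set_integrable_continuous_bounded bounded_cyl0 borel_cyl0
        continuous_intros) simp
  also have "(LINT z:P|lborel. exp (- (\<kappa> * (cmod (z $ first_idx))\<^sup>2 + c)))
      = (LINT z:P|lborel. exp (- c) * exp (- (\<kappa> * (cmod (z $ first_idx))\<^sup>2)))"
    by (simp flip: exp_add add: algebra_simps)
  finally show ?thesis by (simp add: axis_gaussian_def)
qed

section \<open>Optimal extensions from cylinders\<close>

lemma levi_form_thin_cylinder:
  fixes f :: "complex^'n \<Rightarrow> real"
  assumes S: "open S" "smooth_on S f" and x: "x \<in> S" and A: "unitary A" and e: "0 < e"
  defines "\<kappa> \<equiv> levi_form f x (A *v first_axis) (A *v first_axis)"
  obtains \<delta> where "0 < \<delta>" "\<delta> \<le> 1"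
    "\<And>r z. \<lbrakk>0 < r; z \<in> cyl0 r (\<delta> * r)\<rbrakk> \<Longrightarrow>
      \<bar>levi_form f x (A *v z) (A *v z) - \<kappa> * (cmod (z $ first_idx))\<^sup>2\<bar> \<le> e * r\<^sup>2"
proof -
  let ?L = "levi_form f x"
  note bil = bilinear_levi_form[OF S x]
  obtain B where B: "0 < B" "\<And>u v. \<bar>?L u v\<bar> \<le> B * norm u * norm v"
    using bilinear_bounded_pos[OF bil] by auto
  define \<delta> where "\<delta> = min 1 (e / (3 * B))"
  have \<delta>: "0 < \<delta>" "\<delta> \<le> 1" "3 * B * \<delta> \<le> e"
    using B(1) e by (auto simp: \<delta>_def min_def field_simps)
  have "\<bar>?L (A *v z) (A *v z) - \<kappa> * (cmod (z $ first_idx))\<^sup>2\<bar> \<le> e * r\<^sup>2"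
    if r: "0 < r" and z: "z \<in> cyl0 r (\<delta> * r)" for r z
  proof -
    define u where "u = z $ first_idx *s (A *v first_axis)"
    define v where "v = A *v drop_first z"
    have "A *v z = u + v"
      unfolding u_def v_def vector_scalar_commute[symmetric] matrix_vector_right_distrib[symmetric]
        first_drop_decomposition ..
    moreover have "?L u u = \<kappa> * (cmod (z $ first_idx))\<^sup>2"
      by (simp add: u_def \<kappa>_def levi_form_smult[OF S x])
    ultimately have "?L (A *v z) (A *v z) - \<kappa> * (cmod (z $ first_idx))\<^sup>2
        = ?L u v + ?L v u + ?L v v"
      by (simp add: bilinear_ladd[OF bil] bilinear_radd[OF bil])
    moreover have u: "norm u \<le> r" and v: "norm v \<le> \<delta> * r"
      using z by (simp_all add: u_def v_def norm_vector_smult norm_unitary[OF A] norm_axis_1 cyl0_eq)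
    moreover have "norm v \<le> r"
      using v mult_right_mono[OF \<delta>(2), of r] r by linarith
    with u v have "\<bar>?L u v\<bar> \<le> B * r * (\<delta> * r)" "\<bar>?L v u\<bar> \<le> B * (\<delta> * r) * r" "\<bar>?L v v\<bar> \<le> B * (\<delta> * r) * r"
      using B(1) r \<delta>(1) by (auto intro!: order_trans[OF B(2)] mult_mono)
    ultimately have "\<bar>?L (A *v z) (A *v z) - \<kappa> * (cmod (z $ first_idx))\<^sup>2\<bar> \<le> 3 * B * \<delta> * r\<^sup>2"
      by (simp add: power2_eq_square algebra_simps)
    also have "\<dots> \<le> e * r\<^sup>2" using \<delta>(3) by (intro mult_right_mono) auto
    finally show ?thesis .
  qed
  with \<delta> show thesis by (intro that)
qed

lemma thin_cylinder_model:
  fixes f :: "complex^'n \<Rightarrow> real"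
  assumes S: "open S" "smooth_on S f" and x: "x \<in> S" and A: "unitary A" and e: "0 < e"
  defines "\<kappa> \<equiv> levi_form f x (A *v first_axis) (A *v first_axis)"
  obtains q \<delta> \<rho> where "holo_on UNIV q" "q 0 = 0" "0 < \<delta>" "0 < \<rho>"
    "\<And>r z. \<lbrakk>0 < r; r < \<rho>; z \<in> cyl0 r (\<delta> * r)\<rbrakk> \<Longrightarrow> x + A *v z \<in> S"
    "\<And>r z. \<lbrakk>0 < r; r < \<rho>; z \<in> cyl0 r (\<delta> * r)\<rbrakk> \<Longrightarrow>
      \<bar>f (x + A *v z) - f x - Re (q (A *v z)) - \<kappa> * (cmod (z $ first_idx))\<^sup>2\<bar> \<le> e * r\<^sup>2"
proof -
  obtain q d where q: "holo_on UNIV q" "q 0 = 0" and d: "0 < d" "ball x d \<subseteq> S"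
    and taylor: "\<And>z. norm z < d \<Longrightarrow> \<bar>f (x + z) - f x - Re (q z) - levi_form f x z z\<bar> \<le> e / 8 * (norm z)\<^sup>2"
    using levi_expansion[OF S x, of "e / 8"] e by (metis divide_pos_pos zero_less_numeral)
  obtain \<delta> where \<delta>: "0 < \<delta>" "\<delta> \<le> 1" and thin: "\<And>r z. \<lbrakk>0 < r; z \<in> cyl0 r (\<delta> * r)\<rbrakk> \<Longrightarrow>
      \<bar>levi_form f x (A *v z) (A *v z) - \<kappa> * (cmod (z $ first_idx))\<^sup>2\<bar> \<le> e / 2 * r\<^sup>2"
    using levi_form_thin_cylinder[OF S x A half_gt_zero[OF e]] unfolding \<kappa>_def by metis
  have norm_le: "norm (A *v z) \<le> 2 * r" if "0 < r" "z \<in> cyl0 r (\<delta> * r)" for r z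
    using norm_less_of_mem_cyl0[OF that(2)] mult_right_mono[OF \<delta>(2), of r] that(1)
    unfolding norm_unitary[OF A] by linarith
  show thesis
  proof (rule that[OF q \<delta>(1) half_gt_zero[OF d(1)]])
    fix r and z :: "complex^'n" assume r: "0 < r" "r < d / 2" and z: "z \<in> cyl0 r (\<delta> * r)"
    have less: "norm (A *v z) < d" using norm_le[OF r(1) z] r(2) by simp
    then show "x + A *v z \<in> S" using d(2) by (auto simp: dist_norm)
    have "e / 8 * (norm (A *v z))\<^sup>2 \<le> e / 8 * (2 * r)\<^sup>2"
      using norm_le[OF r(1) z] e by (intro mult_left_mono power_mono) auto
    also have "\<dots> = e / 2 * r\<^sup>2" by (simp add: power_mult_distrib)
    finally show "\<bar>f (x + A *v z) - f x - Re (q (A *v z)) - \<kappa> * (cmod (z $ first_idx))\<^sup>2\<bar> \<le> e * r\<^sup>2"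
      using taylor[OF less] thin[OF r(1) z] by linarith
  qed
qed

lemma ex1_normalized_extension_cyl0_imp_eq_0:
  fixes R :: "complex^'n \<Rightarrow> real" and \<kappa> r s :: real
  assumes r: "0 < r" and s: "0 < s" and small: "\<bar>\<kappa>\<bar> * r\<^sup>2 \<le> 1"
    and contR: "continuous_on (cyl0 r s) R"
    and R: "\<And>z. z \<in> cyl0 r s \<Longrightarrow> \<bar>R z - \<kappa> * (cmod (z $ first_idx))\<^sup>2\<bar> \<le> \<bar>\<kappa>\<bar> * r\<^sup>2 / 32"
    and ex1: "\<exists>!g. normalized_extension R (cyl0 r s) g"
  shows "\<kappa> = 0"
proof -
  let ?P = "cyl0 r s :: (complex^'n) set" and ?x = "\<bar>\<kappa>\<bar> * r\<^sup>2 / 32"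
  have V: "0 < measure lborel ?P" by (rule measure_cyl0_pos[OF r s])
  obtain g where g: "normalized_extension R ?P g" using ex1 by blast
  have R_le: "R z \<le> \<kappa> * (cmod (z $ first_idx))\<^sup>2 + ?x"
    and R_ge: "\<kappa> * (cmod (z $ first_idx))\<^sup>2 - ?x \<le> R z" if "z \<in> ?P" for z
    using R[OF that] unfolding abs_le_iff by linarith+
  have "ennreal (exp (- ?x) * axis_gaussian \<kappa> ?P) \<le> ennreal (measure lborel ?P)"
    unfolding set_nn_integral_axis_gaussian_cyl0[symmetric] emeasure_cyl0[symmetric]
    by (rule normalized_extension_imp_mean_le[OF open_cyl0 balanced_cyl0 g])
       (auto intro!: continuous_intros R_le simp: norm_mult)
  then have gaussian_le: "exp (- ?x) * axis_gaussian \<kappa> ?P \<le> measure lborel ?P"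
    by (simp add: ennreal_le_iff)
  have "ennreal (measure lborel ?P) \<le> (\<integral>\<^sup>+ z\<in>?P. ennreal (exp (- R z)) \<partial>lborel)"
    unfolding emeasure_cyl0[symmetric]
    by (rule ex1_normalized_extension_imp_mean_ge[OF open_cyl0 bounded_cyl0 zero_in_cyl0[OF r s] contR ex1])
  also have "\<dots> \<le> (\<integral>\<^sup>+ z\<in>?P. ennreal (exp (- (\<kappa> * (cmod (z $ first_idx))\<^sup>2 + (- ?x)))) \<partial>lborel)"
    using R_ge by (intro nn_integral_mono) (force simp: indicator_def intro: ennreal_leI)
  also have "\<dots> = ennreal (exp ?x * axis_gaussian \<kappa> ?P)"
    unfolding set_nn_integral_axis_gaussian_cyl0 by simp
  finally have "measure lborel ?P \<le> exp ?x * axis_gaussian \<kappa> ?P"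
    using V by (auto simp: ennreal_le_iff2)
  then show ?thesis by (rule axis_gaussian_cyl0_imp_eq_0[OF r s small gaussian_le])
qed

lemma cyl_translate_image: "(\<lambda>z. a + z) ` cyl A r s = (\<lambda>z::complex^'n. a + A *v z) ` cyl0 r s"
  by (simp add: cyl_def image_image)

lemma ex1_optimal_extension_cyl_iff:
  assumes "unitary A" "smooth_on S \<phi>" "(\<lambda>z. a + z) ` cyl A r s \<subseteq> S"
  shows "(\<exists>!f. optimal_extension \<phi> a (cyl A r s) f)
    \<longleftrightarrow> (\<exists>!g. normalized_extension (\<lambda>z. \<phi> (a + A *v z) - \<phi> a) (cyl0 r s) g)"
  unfolding cyl_def
proof (rule ex1_optimal_extension_iff_normalized[OF assms(1) open_cyl0])
  show "continuous_on ((\<lambda>z. a + A *v z) ` cyl0 r s) \<phi>"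
    using smooth_on_imp_continuous_on[OF assms(2)] assms(3) continuous_on_subset
    unfolding cyl_translate_image by blast
qed

lemma pluriharmonic_on_imp_ex1_optimal_extension:
  fixes \<phi> :: "complex^'n \<Rightarrow> real"
  assumes S: "open S" "smooth_on S \<phi>" "pluriharmonic_on S \<phi>" and td: "(a, r, s, A) \<in> Omega_td S"
  shows "\<exists>!f. optimal_extension \<phi> a (cyl A r s) f"
proof -
  have r: "0 < r" "0 < s" and A: "unitary A" and sub: "(\<lambda>z. a + z) ` cyl A r s \<subseteq> S"
    using td by (auto simp: Omega_td_def)
  let ?\<Phi> = "\<lambda>z. a + A *v z" and ?P = "cyl0 r s :: (complex^'n) set"
  note T = orthogonal_transformation_unitary[OF A]
  have "convex ((\<lambda>z. a + z) ` (\<lambda>z. A *v z) ` ?P)"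
    by (intro convex_translation convex_linear_image convex_cyl0 orthogonal_transformation_linear[OF T])
  then have "convex (?\<Phi> ` ?P)" by (simp add: image_image)
  moreover have "open (?\<Phi> ` ?P)"
    by (rule open_orthogonal_affine_image[OF T open_cyl0])
  ultimately obtain h where h: "holo_on (?\<Phi> ` ?P) h" "\<And>x. x \<in> ?\<Phi> ` ?P \<Longrightarrow> Re (h x) = \<phi> x"
    using pluriharmonic_on_imp_Re_holo[OF S] sub unfolding cyl_translate_image by metis
  define q where "q z = h (?\<Phi> z) + (- h a)" for z
  have "holo_on ?P q"
    unfolding q_def by (intro holo_on_add holo_on_const holo_on_compose_affine h)
  moreover have "q 0 = 0" by (simp add: q_def)
  moreover have "\<phi> (?\<Phi> z) - \<phi> a = 0 + Re (q z)" if "z \<in> ?P" for z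
    using h(2)[OF imageI[OF that]] h(2)[OF imageI[OF zero_in_cyl0[OF r]]] by (simp add: q_def)
  ultimately have "(\<exists>!g. normalized_extension (\<lambda>z. \<phi> (?\<Phi> z) - \<phi> a) ?P g)
      \<longleftrightarrow> (\<exists>!g. normalized_extension (\<lambda>_. 0) ?P g)"
    by (rule ex1_normalized_extension_gauge)
  then show ?thesis
    unfolding ex1_optimal_extension_cyl_iff[OF A S(2) sub]
    using ex1_normalized_extension_0[OF open_cyl0 balanced_cyl0 _ zero_in_cyl0[OF r]]
      emeasure_bounded_finite[OF bounded_cyl0] by blast
qed

lemma ex1_optimal_extension_imp_levi_form_eq_0:
  fixes \<phi> :: "complex^'n \<Rightarrow> real"
  assumes S: "open S" "smooth_on S \<phi>" and a: "a \<in> S" and A: "unitary A"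
    and ex1: "\<And>r s. (a, r, s, A) \<in> Omega_td S \<Longrightarrow> \<exists>!f. optimal_extension \<phi> a (cyl A r s) f"
  shows "levi_form \<phi> a (A *v first_axis) (A *v first_axis) = 0"
proof (rule ccontr)
  define \<kappa> where "\<kappa> = levi_form \<phi> a (A *v first_axis) (A *v first_axis)"
  assume "levi_form \<phi> a (A *v first_axis) (A *v first_axis) \<noteq> 0"
  then have e: "0 < \<bar>\<kappa>\<bar> / 32" and \<kappa>: "\<kappa> \<noteq> 0" by (simp_all add: \<kappa>_def)
  obtain q \<delta> \<rho> where q: "holo_on UNIV q" "q 0 = 0" and \<delta>: "0 < \<delta>" and \<rho>: "0 < \<rho>"
    and inS: "\<And>r z. \<lbrakk>0 < r; r < \<rho>; z \<in> cyl0 r (\<delta> * r)\<rbrakk> \<Longrightarrow> a + A *v z \<in> S"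
    and model: "\<And>r z. \<lbrakk>0 < r; r < \<rho>; z \<in> cyl0 r (\<delta> * r)\<rbrakk> \<Longrightarrow>
      \<bar>\<phi> (a + A *v z) - \<phi> a - Re (q (A *v z)) - \<kappa> * (cmod (z $ first_idx))\<^sup>2\<bar> \<le> \<bar>\<kappa>\<bar> / 32 * r\<^sup>2"
    using thin_cylinder_model[OF S a A e] unfolding \<kappa>_def by metis
  define r where "r = min (\<rho> / 2) (1 / sqrt \<bar>\<kappa>\<bar>)"
  have r: "0 < r" "r < \<rho>" using \<rho> \<kappa> by (auto simp: r_def)
  then have "r\<^sup>2 \<le> (1 / sqrt \<bar>\<kappa>\<bar>)\<^sup>2" by (intro power_mono) (auto simp: r_def)
  then have small: "\<bar>\<kappa>\<bar> * r\<^sup>2 \<le> 1" using \<kappa> by (simp add: power_divide field_simps)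
  define s where "s = \<delta> * r"
  have s: "0 < s" using \<delta> r by (simp add: s_def)
  let ?P = "cyl0 r s :: (complex^'n) set"
  define R where "R z = \<phi> (a + A *v z) - \<phi> a - Re (q (A *v z))" for z
  have sub: "(\<lambda>z. a + z) ` cyl A r s \<subseteq> S"
    unfolding cyl_translate_image s_def using inS[OF r] by blast
  have qA: "holo_on ?P (\<lambda>z. q (0 + A *v z))" "q (0 + A *v 0) = 0"
    by (rule holo_on_compose_affine[OF holo_on_subset[OF q(1) subset_UNIV]]) (simp add: q(2))
  have "\<exists>!g. normalized_extension (\<lambda>z. \<phi> (a + A *v z) - \<phi> a) ?P g"
    using ex1[of r s] a r s A sub ex1_optimal_extension_cyl_iff[OF A S(2) sub] by (simp add: Omega_td_def)
  then have "\<exists>!g. normalized_extension R ?P g"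
    using ex1_normalized_extension_gauge[OF qA, of "\<lambda>z. \<phi> (a + A *v z) - \<phi> a" R] by (simp add: R_def)
  moreover have "continuous_on ?P R"
    unfolding R_def using inS[OF r]
    by (intro continuous_intros continuous_on_compose2[OF smooth_on_imp_continuous_on[OF S(2)]]
        linear_continuous_on bounded_linear_matrix_vector_mult
        holo_on_imp_continuous_on[OF qA(1), simplified])
      (auto simp: s_def)
  moreover have "\<bar>R z - \<kappa> * (cmod (z $ first_idx))\<^sup>2\<bar> \<le> \<bar>\<kappa>\<bar> * r\<^sup>2 / 32" if "z \<in> ?P" for z
    using model[OF r, of z] that by (simp add: R_def s_def)
  ultimately show False
    using ex1_normalized_extension_cyl0_imp_eq_0[OF r(1) s small] \<kappa> by blast
qed

lemma ex1_optimal_extension_imp_pluriharmonic_on: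
  fixes \<phi> :: "complex^'n \<Rightarrow> real"
  assumes S: "open S" "smooth_on S \<phi>"
    and ex1: "\<And>a r s A. (a, r, s, A) \<in> Omega_td S \<Longrightarrow> \<exists>!f. optimal_extension \<phi> a (cyl A r s) f"
  shows "pluriharmonic_on S \<phi>"
  unfolding pluriharmonic_on_iff_levi_form[OF S]
proof (intro ballI allI)
  fix a u assume a: "a \<in> S"
  show "levi_form \<phi> a u u = 0"
  proof (cases "u = 0")
    case False
    then obtain A c where A: "unitary A" and c: "c \<noteq> 0" "A *v first_axis = c *s u"
      by (rule ex_unitary_mult_first_axis)
    have "levi_form \<phi> a (c *s u) (c *s u) = 0"
      using ex1_optimal_extension_imp_levi_form_eq_0[OF S a A ex1] unfolding c(2) .
    then show ?thesis using c(1) by (simp add: levi_form_smult[OF S a])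
  qed (simp add: bilinear_lzero[OF bilinear_levi_form[OF S a]])
qed

theorem theoremA1:
  fixes \<Omega> :: "(complex^'n) set" and \<phi> :: "complex^'n \<Rightarrow> real"
  assumes "open \<Omega>" and "connected \<Omega>" and "\<Omega> \<noteq> {}"
    and "smooth_on \<Omega> \<phi>"
  shows "pluriharmonic_on \<Omega> \<phi> \<longleftrightarrow>
    (\<forall>(a, r, s, A) \<in> Omega_td \<Omega>.
       \<exists>!f. holo_on ((\<lambda>z. a + z) ` cyl A r s) f \<and>
            (\<forall>x. x \<notin> (\<lambda>z. a + z) ` cyl A r s \<longrightarrow> f x = 0) \<and>
            f a = 1 \<and>
            (\<integral>\<^sup>+ x \<in> (\<lambda>z. a + z) ` cyl A r s. ennreal ((cmod (f x))\<^sup>2 * exp (- \<phi> x)) \<partial>lebesgue)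
              \<le> emeasure lebesgue (cyl A r s) * ennreal (exp (- \<phi> a)))"
  unfolding optimal_extension_def[symmetric]
proof
  assume "pluriharmonic_on \<Omega> \<phi>"
  then show "\<forall>(a, r, s, A) \<in> Omega_td \<Omega>. \<exists>!f. optimal_extension \<phi> a (cyl A r s) f"
    using pluriharmonic_on_imp_ex1_optimal_extension[OF assms(1,4)] by blast
next
  assume "\<forall>(a, r, s, A) \<in> Omega_td \<Omega>. \<exists>!f. optimal_extension \<phi> a (cyl A r s) f"
  then show "pluriharmonic_on \<Omega> \<phi>"
    by (intro ex1_optimal_extension_imp_pluriharmonic_on[OF assms(1,4)]) blast
qed

end
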